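(* Let $p$ and $q$ be positive integers and $g\in S^{\circ}_q(\theta)$ with $g=a\theta^{p/q}+\underline{o}(\theta^{p/q})$, $a\in\Bbbk$, $a\neq 0$. Then $$\mathcal{M}^{-(0,\infty)}(D_g)\simeq E_f,$$ where $f\in R^{\circ}_{p}(z)$ is determined by the following system of equations: $$g+a\left(\frac{p+q}{2q}\right)\theta^{1+(p/q)}=z,$$ $$f=-\theta^{-1}.$$
   Context: $\Bbbk$ is an algebraically closed field of characteristic zero. The notation $\underline{o}(\theta^{k})$ denotes a series all of whose terms have order $>k$; $\mathrm{ord}$ is the order of vanishing of a (Puiseux-)Laurent series. **Connections.** Let $K=\Bbbk((z))$. Objects of $\mathcal{C}_0$ are pairs $(V,\nabla)$, $V$ a finite-dimensional $K$-vector space, $\nabla:V\to V$ a $\Bbbk$-linear map with $\nabla(hv)=h\nabla(v)+\frac{dh}{dz}v$ for $h\in K$; morphisms are $K$-linear maps commuting with the $\nabla$'s. For $m\ge1$ let $K_m=\Bbbk((z^{1/m}))$; for $f\in K_m$ set $E_f=(K_m,\frac{d}{dz}+z^{-1}f)$, viewed over $K$. Let $R_m=R_m(z)$ be the set of orbits of $\mathrm{Gal}(K_m/K)$ (acting by $z^{1/m}\mapsto\eta z^{1/m}$, $\eta^m=1$) on $K_m/\left(z^{1/m}\Bbbk[[z^{1/m}]]+\frac{\mathbb{Z}}{m}\right)$, and $R_m^\circ\subset R_m$ the set of classes that cannot be represented by elements of $K_{m'}$ for any $0<m'<m$. The isomorphism class of $E_f$ depends only on the class of $f$ in $R_m$.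 **Difference operators.** Over $\Bbbk((\theta))$, let $\varphi$ be the $\Bbbk$-automorphism $\varphi(v(\theta))=v\left(\frac{\theta}{1+\theta}\right)$, extended to $\Bbbk((\theta^{1/q}))$ by $\varphi(v(\theta^{1/q}))=v\left(\theta^{1/q}\sum_{i\ge0}\binom{-1/q}{i}\theta^i\right)$. Objects of $\mathcal{N}$ are pairs $(V,\Phi)$, $V$ a finite-dimensional $\Bbbk((\theta))$-vector space and $\Phi:V\to V$ an invertible $\Bbbk$-linear map with $\Phi(hv)=\varphi(h)\Phi(v)$ for all $h\in\Bbbk((\theta))$; morphisms are $\Bbbk((\theta))$-linear maps commuting with the $\Phi$'s. For $g\in\Bbbk((\theta^{1/q}))^*$ set $D_g=(\Bbbk((\theta^{1/q})),g\varphi)$, viewed over $\Bbbk((\theta))$. Let $S_q=S_q(\theta)$ be the set of orbits of $\mathrm{Gal}(\Bbbk((\theta^{1/q}))/\Bbbk((\theta)))$ on the multiplicative quotient $\Bbbk((\theta^{1/q}))^*/\left(1+\frac{\mathbb{Z}}{q}\theta+\theta^{1+(1/q)}\Bbbk[[\theta^{1/q}]]\right)$, and $S_q^\circ\subset S_q$ the set of classes that cannot be represented by elements of $\Bbbk((\theta^{1/q'}))^*$ for any $0<q'<q$. The isomorphism class of $D_g$ depends only on the class of $g$ in $S_q$; $g\in S_q^\circ$ is identified with a representative in $\Bbbk((\theta^{1/q}))^*$. Every irreducible object of $\mathcal{N}$ is isomorphic to some $D_g$ with $g\in S_q^\circ$. $\mathcal{N}^{>0}$ is the full subcategory of objects whose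 irreducible components $D_g$ all have $\mathrm{ord}(g)>0$. **Local inverse Mellin transform.** For $D=(V,\Phi)\in\mathcal{N}^{>0}$ put $z:=\Phi:V\to V$ and $\nabla:=-(\theta\Phi)^{-1}:V\to V$. Then $z$ extends to an action of $\Bbbk((z))$ on $V$ (compatible with the topology: the $z$-adic topology on $V$ coincides with the $\theta$-adic topology), $V$ is finite-dimensional over $\Bbbk((z))$ (written $V_z$), $\nabla$ is a connection, and $\mathcal{M}^{-(0,\infty)}(D):=(V_z,\nabla)\in\mathcal{C}_0$. **How the system determines $f$.** In the system $z$ and $\theta$ are commuting formal variables. The first equation is solved explicitly for $\theta$ as an element of $\Bbbk((z^{1/p}))$, and this is substituted into the second equation to give $f\in\Bbbk((z^{1/p}))$; different choices of roots give the same Galois orbit. *)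

theory Defs
  imports
    "HOL-Computational_Algebra.Formal_Laurent_Series"
    "HOL-Analysis.Abstract_Topology"
begin

text \<open>
  The field \<open>\<Bbbk>((x\<^bsup>1/m\<^esup>))\<close> is represented by \<^typ>\<open>'k fls\<close>, with \<^const>\<open>fls_X\<close> standing for
  \<open>x\<^bsup>1/m\<^esup>\<close>; the index \<open>m\<close> is carried by the operations below.  The inclusion
  \<open>\<Bbbk>((x\<^bsup>1/m\<^esup>)) \<subseteq> \<Bbbk>((x\<^bsup>1/(mn)\<^esup>))\<close> is then \<open>\<lambda>h. fls_compose_power h n\<close>.

  An object (a vector space \<open>V\<close> over \<open>\<Bbbk>((x))\<close> with an operator) is a pair consisting of the scalar
  multiplication of \<open>\<Bbbk>((x))\<close> on the additive group of a type \<open>'v\<close>, and the operator.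
\<close>

type_synonym ('k, 'v) fls_module = "('k fls \<Rightarrow> 'v \<Rightarrow> 'v) \<times> ('v \<Rightarrow> 'v)"

definition finite_spanning :: "('k::field fls \<Rightarrow> 'v::ab_group_add \<Rightarrow> 'v) \<Rightarrow> 'v set \<Rightarrow> bool" where
  "finite_spanning scale B \<longleftrightarrow> finite B \<and> module.span scale B = UNIV"

unbundle fps_syntax

lemma compose_power_conv_compose_fps:
  assumes "d > 0"
  shows "fls_compose_power f d = fls_compose_fps f (fps_X ^ d :: 'k::field fps)"
proof -
  obtain n f' where f: "f = fls_shift (int n) (fps_to_fls f')"
    using fls_as_fps[of f "nat (- fls_subdegree f)"] by (metis nat_le_iff order_refl)
  have z: "fps_nth (fps_X ^ d :: 'k fps) 0 = 0" using assms by simp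
  have "fls_compose_fps f (fps_X ^ d) = fps_to_fls (f' oo fps_X ^ d) * (fls_X ^ d) powi (- int n)"
    unfolding f by (subst fls_compose_fps_shift) (use assms z in \<open>simp_all add: fps_to_fls_power\<close>)
  also have "(fls_X ^ d) powi (- int n) = (fls_X_intpow (- int (d * n)) :: 'k fls)"
  proof -
    have "(fls_X ^ d) powi (- int n) = (fls_X :: 'k fls) powi (int d * (- int n))"
      by (simp only: power_int_mult power_int_of_nat)
    then show ?thesis by simp
  qed
  finally have "fls_compose_fps f (fps_X ^ d) = fps_to_fls (f' oo fps_X ^ d) * fls_X_intpow (- int (d * n))" .
  then show ?thesis using assms z unfolding f
    by (simp add: fls_compose_power_fps_to_fls fls_shifted_times_simps)
qed

lemma finite_spanning_monomials:
  assumes q: "q > 0"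
  shows "finite_spanning (\<lambda>h v. fls_compose_power h q * v) ((\<lambda>i. fls_X ^ i :: 'k::field fls) ` {..<q})"
proof -
  let ?s = "\<lambda>h v :: 'k fls. fls_compose_power h q * v"
  interpret vector_space ?s using q by unfold_locales (auto simp: algebra_simps)
  have "v \<in> span ((\<lambda>i. fls_X ^ i) ` {..<q})" for v :: "'k fls"
  proof -
    define h where "h i = Abs_fls (\<lambda>n. v $$ (int q * n + int i))" for i
    have h: "h i $$ n = v $$ (int q * n + int i)" if "i < q" for i n
    proof -
      have "\<forall>n<fls_subdegree v - 1 + - \<bar>fls_subdegree v\<bar> - 1. v $$ (int q * n + int i) = 0"
      proof (intro allI impI)
        fix n assume n: "n < fls_subdegree v - 1 + - \<bar>fls_subdegree v\<bar> - 1"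
        then have "int q * n + int i < int q * (n + 1)" "n + 1 \<le> 0" using that by (auto simp: algebra_simps)
        moreover from this have "int q * (n + 1) \<le> n + 1" 
          using q mult_right_mono_neg[of 1 "int q" "n + 1"] by simp
        ultimately show "v $$ (int q * n + int i) = 0" using n by simp
      qed
      then show ?thesis unfolding h_def by (rule nth_Abs_fls_lower_bound)
    qed
    have sum_nth: "(\<Sum>i\<in>A. F i) $$ n = (\<Sum>i\<in>A. F i $$ n)" for A and F :: "nat \<Rightarrow> 'k fls" and n
      by (induction A rule: infinite_finite_induct) auto
    have "v = (\<Sum>i<q. ?s (h i) (fls_X ^ i))"
    proof (rule fls_eqI)
      fix n
      have "(\<Sum>i<q. ?s (h i) (fls_X ^ i)) $$ n = (\<Sum>i<q. if i = nat (n mod int q) then v $$ n else 0)"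
        unfolding sum_nth
      proof (rule sum.cong[OF refl])
        fix i assume "i \<in> {..<q}"
        then have i: "i < q" by simp
        have e: "?s (h i) (fls_X ^ i) $$ n = fls_compose_power (h i) q $$ (n - int i)"
          by (simp add: fls_X_power_times_conv_shift)
        show "?s (h i) (fls_X ^ i) $$ n = (if i = nat (n mod int q) then v $$ n else 0)"
        proof (cases "int q dvd n - int i")
          case True
          then have "n mod int q = int i" using i by (metis mod_eq_dvd_iff mod_pos_pos_trivial of_nat_0_le_iff of_nat_less_iff)
          then show ?thesis using True e q i by (simp add: fls_nth_compose_power h)
        next
          case False
          then have "i \<noteq> nat (n mod int q)" using q by (metis dvd_minus_mod nat_0_le of_nat_0_less_iff pos_mod_sign)
          then show ?thesis using False e q by (simp add: fls_nth_compose_power)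
        qed
      qed
      also have "\<dots> = v $$ n" using q by (simp add: nat_less_iff)
      finally show "v $$ n = (\<Sum>i<q. ?s (h i) (fls_X ^ i)) $$ n" ..
    qed
    then show ?thesis by (metis (no_types, lifting) imageI span_base span_scale span_sum)
  qed
  then show ?thesis by (auto simp: finite_spanning_def)
qed


section \<open>Galois action\<close>

text \<open>The automorphism \<open>x\<^bsup>1/m\<^esup> \<mapsto> \<eta> x\<^bsup>1/m\<^esup>\<close>; the Galois group consists of those with \<open>\<eta>\<^sup>m = 1\<close>.\<close>

definition galois :: "'k::field \<Rightarrow> 'k fls \<Rightarrow> 'k fls" where
  "galois \<eta> v = fls_compose_fps v (fps_const \<eta> * fps_X)"

text \<open>
  For \<open>u \<in> \<Bbbk>((x\<^bsup>1/m\<^esup>))\<close>: \<open>u\<close> lies in \<open>\<Bbbk>((x\<^bsup>1/n\<^esup>))\<close>.  Here \<open>n\<close> need not divide \<open>m\<close>, and the two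
  fields are compared inside \<open>\<Bbbk>((x\<^bsup>1/(mn)\<^esup>))\<close>.
\<close>

definition in_ramified :: "nat \<Rightarrow> nat \<Rightarrow> 'k::zero fls \<Rightarrow> bool" where
  "in_ramified m n u \<longleftrightarrow> (\<exists>h. fls_compose_power u n = fls_compose_power h m)"


section \<open>Connections\<close>

locale connection = vector_space scale
  for scale :: "'k::field_char_0 fls \<Rightarrow> 'v::ab_group_add \<Rightarrow> 'v" and nabla :: "'v \<Rightarrow> 'v" +
  assumes finite_dim: "\<exists>B. finite_spanning scale B"
    and nabla_add: "nabla (v + w) = nabla v + nabla w"
    and nabla_const: "nabla (scale (fls_const c) v) = scale (fls_const c) (nabla v)"
    and leibniz: "nabla (scale h v) = scale h (nabla v) + scale (fls_deriv h) v"

definition connection_iso ::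
  "('k::field_char_0, 'v::ab_group_add) fls_module \<Rightarrow> ('k, 'w::ab_group_add) fls_module \<Rightarrow> bool" where
  "connection_iso C C' \<longleftrightarrow>
     connection (fst C) (snd C) \<and> connection (fst C') (snd C') \<and>
     (\<exists>T. Vector_Spaces.linear (fst C) (fst C') T \<and> bij T \<and> (\<forall>v. T (snd C v) = snd C' (T v)))"

text \<open>With \<open>s = z\<^bsup>1/m\<^esup>\<close>, the derivation \<open>d/dz\<close> of \<open>\<Bbbk>((s))\<close> is \<open>(dz/ds)\<^sup>-\<^sup>1 d/ds\<close>, where \<open>z = s\<^sup>m\<close>.\<close>

definition deriv_z :: "nat \<Rightarrow> 'k::field_char_0 fls \<Rightarrow> 'k fls" where
  "deriv_z m v = fls_deriv v / fls_deriv (fls_X ^ m)"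

definition E_obj :: "nat \<Rightarrow> 'k::field_char_0 fls \<Rightarrow> ('k, 'k fls) fls_module" where
  "E_obj m f = (\<lambda>h v. fls_compose_power h m * v, \<lambda>v. deriv_z m v + inverse (fls_X ^ m) * f * v)"

lemma connection_E_obj:
  assumes "m > 0"
  shows "connection (fst (E_obj m f)) (snd (E_obj m f))"
proof -
  have d: "deriv_z m (fls_compose_power h m) = fls_compose_power (fls_deriv h) m" for h :: "'a fls"
  proof -
    have "fls_deriv (fls_compose_power h m) = fls_compose_power (fls_deriv h) m * fls_deriv (fls_X ^ m)"
    proof (rule fls_eqI)
      fix n
      have D: "fls_deriv (fls_X ^ m) = fls_shift (1 - int m) (fls_const (of_nat m) :: 'a fls)"
        using assms by (simp add: fls_X_power_conv_shift_1 fls_deriv_X_intpow fls_of_nat fls_shifted_times_simps)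
      have "(fls_compose_power (fls_deriv h) m * fls_deriv (fls_X ^ m)) $$ n = 
         fls_compose_power (fls_deriv h) m $$ (n + 1 - int m) * of_nat m"
        unfolding D by (simp add: fls_shifted_times_simps algebra_simps)
      moreover have "int m dvd n + 1 - int m \<longleftrightarrow> int m dvd n + 1" using dvd_add_left_iff[of "int m" "int m" "n + 1 - int m"] by simp
      ultimately show "fls_deriv (fls_compose_power h m) $$ n
          = (fls_compose_power (fls_deriv h) m * fls_deriv (fls_X ^ m)) $$ n"
      proof (cases "int m dvd n + 1")
        case True
        then obtain k where "n + 1 = int m * k" by (elim dvdE)
        then have n: "n = int m * k - 1" by simp
        have "(int m * k - int m) div int m = k - 1"
          using assms by (metis mult.right_neutral nonzero_mult_div_cancel_left of_nat_eq_0_iff not_gr_zero right_diff_distrib')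
        with \<open>_ = _ * of_nat m\<close> show ?thesis using assms
          by (simp add: n fls_nth_compose_power)
      qed (use assms in \<open>simp add: fls_nth_compose_power\<close>)
    qed
    moreover have "fls_deriv (fls_X ^ m :: 'a fls) \<noteq> 0" using assms by (simp add: fls_deriv_power)
    ultimately show ?thesis by (simp add: deriv_z_def)
  qed
  have mult: "deriv_z m (v * w) = v * deriv_z m w + deriv_z m v * w" for v w :: "'a fls"
    by (simp add: deriv_z_def add_divide_distrib)
  show ?thesis unfolding E_obj_def fst_conv snd_conv
  proof unfold_locales
    show "\<exists>B. finite_spanning (\<lambda>h v. fls_compose_power h m * (v::'a fls)) B"
      using finite_spanning_monomials[OF assms] by blast
  next
    fix v w :: "'a fls"
    show "deriv_z m (v + w) + inverse (fls_X ^ m) * f * (v + w) =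
      deriv_z m v + inverse (fls_X ^ m) * f * v + (deriv_z m w + inverse (fls_X ^ m) * f * w)"
      by (simp add: deriv_z_def add_divide_distrib algebra_simps)
  qed (use assms d in \<open>simp_all add: mult d algebra_simps\<close>, simp add: deriv_z_def)
qed

text \<open>
  \<open>R_class m f\<close> is the class of \<open>f\<close> in \<open>R\<^sub>m\<close>: a Galois orbit in the quotient by
  \<open>z\<^bsup>1/m\<^esup> \<Bbbk>[[z\<^bsup>1/m\<^esup>]] + \<int>/m\<close>, regarded as a union of cosets.
\<close>

definition R_class :: "nat \<Rightarrow> 'k::field_char_0 fls \<Rightarrow> 'k fls set" where
  "R_class m f = {galois \<eta> f + fls_const (of_int n / of_nat m) + fls_X * fps_to_fls r | \<eta> n r.
                    \<eta> ^ m = 1}"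

definition R_set :: "nat \<Rightarrow> 'k::field_char_0 fls set set" where
  "R_set m = range (R_class m)"

definition R_circ :: "nat \<Rightarrow> 'k::field_char_0 fls set set" where
  "R_circ m = {C \<in> R_set m. \<not> (\<exists>m'. 0 < m' \<and> m' < m \<and> (\<exists>f\<in>C. in_ramified m m' f))}"


section \<open>Difference operators\<close>

text \<open>\<open>\<phi>\<close> on \<open>\<Bbbk>((\<theta>\<^bsup>1/q\<^esup>))\<close>, where \<open>\<phi>(\<theta>\<^bsup>1/q\<^esup>) = \<theta>\<^bsup>1/q\<^esup> (1 + \<theta>)\<^bsup>-1/q\<^esup>\<close>.\<close>

definition phi :: "nat \<Rightarrow> 'k::field_char_0 fls \<Rightarrow> 'k fls" where
  "phi q v = fls_compose_fps v
     (fps_X * fps_compose (fps_binomial (- 1 / of_nat q)) (fps_X ^ q))"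

locale difference_module = vector_space scale
  for scale :: "'k::field_char_0 fls \<Rightarrow> 'v::ab_group_add \<Rightarrow> 'v" and Phi :: "'v \<Rightarrow> 'v" +
  assumes finite_dim: "\<exists>B. finite_spanning scale B"
    and bij_Phi: "bij Phi"
    and Phi_add: "Phi (v + w) = Phi v + Phi w"
    and Phi_const: "Phi (scale (fls_const c) v) = scale (fls_const c) (Phi v)"
    and Phi_semilinear: "Phi (scale h v) = scale (phi 1 h) (Phi v)"

definition D_obj :: "nat \<Rightarrow> 'k::field_char_0 fls \<Rightarrow> ('k, 'k fls) fls_module" where
  "D_obj q g = (\<lambda>h v. fls_compose_power h q * v, \<lambda>v. g * phi q v)"

lemma difference_module_D_obj:
  assumes q: "q > 0" and "g \<noteq> 0"
  shows "difference_module (fst (D_obj q g)) (snd (D_obj q g))"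
proof -
  define G :: "nat \<Rightarrow> 'a fps" where "G q = fps_X * fps_compose (fps_binomial (- 1 / of_nat q)) (fps_X ^ q)" for q
  have phi: "phi q v = fls_compose_fps v (G q)" for q v by (simp add: phi_def G_def)
  have G0: "fps_nth (G q) 0 = 0" for q by (simp add: G_def)
  have G1: "fps_nth (G q) (Suc 0) = 1" for q by (simp add: G_def)
  have Gnz: "G q \<noteq> 0" for q using G1[of q] by auto
  note [simp] = G0 G1 Gnz
  have add: "phi q (v + w) = phi q v + phi q w" for v w :: "'a fls" by (simp add: phi fls_compose_fps_add)
  have mult: "phi q (v * w) = phi q v * phi q w" for v w :: "'a fls" by (simp add: phi fls_compose_fps_mult)
  have "G q ^ q = G 1 oo fps_X ^ q"
    using q fps_compose_power[of "fps_X ^ q" "fps_binomial (- 1 / of_nat q) :: 'a fps" q]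
    by (simp add: G_def power_mult_distrib fps_compose_mult_distrib fps_binomial_power)
  then have comp: "phi q (fls_compose_power h q) = fls_compose_power (phi 1 h) q" for h :: "'a fls"
    using q by (simp add: phi compose_power_conv_compose_fps fls_compose_fps_assoc flip: fps_compose_power)
  have inv: "fps_nth (fps_inv (G q)) 0 = 0" "fps_inv (G q) \<noteq> 0"
    using fps_inv[of "G q"] G1 by (auto simp: fps_inv_def)
  have bijphi: "bij (phi q :: 'a fls \<Rightarrow> _)"
  proof (rule o_bij)
    have r: "fls_compose_fps v fps_X = v" for v :: "'a fls"
      
      using fls_nth_fls_compose_fps_linear[of 1 v] by (intro fls_eqI) simp
    show "(\<lambda>v. fls_compose_fps v (fps_inv (G q))) \<circ> phi q = id"
      by (auto simp: fun_eq_iff phi fls_compose_fps_assoc inv r fps_inv_right)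
    show "phi q \<circ> (\<lambda>v. fls_compose_fps v (fps_inv (G q))) = id"
      by (auto simp: fun_eq_iff phi fls_compose_fps_assoc inv r fps_inv)
  qed
  have bij: "bij (\<lambda>v. g * phi q v)"
  proof -
    have "bij (\<lambda>v. g * v)" using \<open>g \<noteq> 0\<close> by (intro o_bij[of "\<lambda>v. v / g"]) auto
    from bij_comp[OF bijphi this] show ?thesis by (simp add: comp_def)
  qed
  show ?thesis unfolding D_obj_def fst_conv snd_conv
  proof unfold_locales
    show "\<exists>B. finite_spanning (\<lambda>h v. fls_compose_power h q * (v::'a fls)) B"
      using finite_spanning_monomials[OF q] by blast
  qed (use q bij in \<open>simp_all add: add mult comp algebra_simps\<close>, simp add: phi)
qed

text \<open>The class of \<open>g\<close> in \<open>S\<^sub>q\<close> (for \<open>g \<noteq> 0\<close>), again as a set of representatives.\<close>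

definition S_class :: "nat \<Rightarrow> 'k::field_char_0 fls \<Rightarrow> 'k fls set" where
  "S_class q g = {galois \<eta> g * (1 + fls_const (of_int n / of_nat q) * fls_X ^ q
                                  + fls_X ^ (q + 1) * fps_to_fls r) | \<eta> n r. \<eta> ^ q = 1}"

definition S_set :: "nat \<Rightarrow> 'k::field_char_0 fls set set" where
  "S_set q = S_class q ` (UNIV - {0})"

definition S_circ :: "nat \<Rightarrow> 'k::field_char_0 fls set set" where
  "S_circ q = {C \<in> S_set q. \<not> (\<exists>q'. 0 < q' \<and> q' < q \<and> (\<exists>g\<in>C. in_ramified q q' g))}"


section \<open>Local inverse Mellin transform\<close>

text \<open>\<open>x\<^sup>N L\<close>, where \<open>L\<close> is the \<open>\<Bbbk>[[x]]\<close>-lattice generated by \<open>B\<close>.\<close>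

definition lattice_power ::
  "('k::field fls \<Rightarrow> 'v::ab_group_add \<Rightarrow> 'v) \<Rightarrow> 'v set \<Rightarrow> nat \<Rightarrow> 'v set" where
  "lattice_power scale B N = {\<Sum>b\<in>B. scale (fls_X ^ N * fps_to_fls (c b)) b | c. True}"

text \<open>The \<open>x\<close>-adic topology of a finite-dimensional \<open>\<Bbbk>((x))\<close>-vector space.\<close>

definition adic_open ::
  "('k::field fls \<Rightarrow> 'v::ab_group_add \<Rightarrow> 'v) \<Rightarrow> 'v set \<Rightarrow> bool" where
  "adic_open scale U \<longleftrightarrow>
     (\<forall>v\<in>U. \<forall>B. finite_spanning scale B \<longrightarrow> (\<exists>N. (\<lambda>w. v + w) ` lattice_power scale B N \<subseteq> U))"

definition adic_topology ::
  "('k::field fls \<Rightarrow> 'v::ab_group_add \<Rightarrow> 'v) \<Rightarrow> 'v topology" where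
  "adic_topology scale = topology (adic_open scale)"

lemma lattice_power_antimono:
  assumes "M \<le> N"
  shows "lattice_power scale B N \<subseteq> lattice_power scale B M"
proof
  fix v assume "v \<in> lattice_power scale B N"
  then obtain c where c: "v = (\<Sum>b\<in>B. scale (fls_X ^ N * fps_to_fls (c b)) b)"
    by (auto simp: lattice_power_def)
  have "fls_X ^ N * fps_to_fls (c b) = fls_X ^ M * fps_to_fls (fps_X ^ (N - M) * c b)" for b
    using assms by (simp add: fls_times_fps_to_fls fps_to_fls_power flip: power_add mult.assoc)
  then have "v = (\<Sum>b\<in>B. scale (fls_X ^ M * fps_to_fls (fps_X ^ (N - M) * c b)) b)"
    by (simp only: c)
  then show "v \<in> lattice_power scale B M"
    by (auto simp: lattice_power_def intro!: exI[of _ "\<lambda>b. fps_X ^ (N - M) * c b"])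
qed

lemma openin_adic_topology: "openin (adic_topology scale) = adic_open scale"
proof -
  have "istopology (adic_open scale)"
    unfolding istopology_def
  proof (intro conjI allI impI)
    fix S T assume S: "adic_open scale S" and T: "adic_open scale T"
    show "adic_open scale (S \<inter> T)"
      unfolding adic_open_def
    proof (intro ballI allI impI)
      fix v B assume v: "v \<in> S \<inter> T" and B: "finite_spanning scale B"
      obtain M N where "(\<lambda>w. v + w) ` lattice_power scale B M \<subseteq> S"
        and "(\<lambda>w. v + w) ` lattice_power scale B N \<subseteq> T"
        using S T v B unfolding adic_open_def by blast
      then have "(\<lambda>w. v + w) ` lattice_power scale B (max M N) \<subseteq> S \<inter> T"
        using lattice_power_antimono[of M "max M N" scale B]
          lattice_power_antimono[of N "max M N" scale B] by fastforce
      then show "\<exists>N. (\<lambda>w. v + w) ` lattice_power scale B N \<subseteq> S \<inter> T" ..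
    qed
  next
    fix K assume "\<forall>S\<in>K. adic_open scale S"
    then show "adic_open scale (\<Union>K)"
      unfolding adic_open_def by (meson Union_iff Union_upper subset_trans)
  qed
  then show ?thesis by (simp add: adic_topology_def)
qed

text \<open>
  \<open>act\<close> extends \<open>z := \<Phi>\<close> to an action of \<open>\<Bbbk>((z))\<close> on \<open>V\<close>, compatible with the action of \<open>\<Bbbk>\<close>, for
  which \<open>V\<close> is finite-dimensional and the \<open>z\<close>-adic topology is the \<open>\<theta>\<close>-adic one.  There is at most
  one such action: it is determined on Laurent polynomials in \<open>z\<close>, and it is continuous.
\<close>

definition z_action ::
  "('k::field_char_0, 'v::ab_group_add) fls_module \<Rightarrow> ('k fls \<Rightarrow> 'v \<Rightarrow> 'v) \<Rightarrow> bool" where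
  "z_action D act \<longleftrightarrow>
     vector_space act \<and> (\<exists>B. finite_spanning act B) \<and>
     (\<forall>c v. act (fls_const c) v = fst D (fls_const c) v) \<and>
     (\<forall>v. act fls_X v = snd D v) \<and>
     adic_topology act = adic_topology (fst D)"

text \<open>\<open>\<M>\<^bsup>-(0,\<infinity>)\<^esup>(V, \<Phi>) = (V\<^sub>z, -(\<theta>\<Phi>)\<^sup>-\<^sup>1)\<close>; only meaningful when a \<open>z_action\<close> exists.\<close>

definition inverse_mellin ::
  "('k::field_char_0, 'v::ab_group_add) fls_module \<Rightarrow> ('k, 'v) fls_module" where
  "inverse_mellin D =
     ((THE act. z_action D act), \<lambda>v. - inv (\<lambda>u. fst D fls_X (snd D u)) v)"


section \<open>The system of equations\<close>

text \<open>
  \<open>f\<close> is obtained from the system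
  \<open>g + a (p+q)/(2q) \<theta>\<^bsup>1+p/q\<^esup> = z\<close>, \<open>f = -\<theta>\<^sup>-\<^sup>1\<close>.
  Solving the first equation for \<open>\<theta>\<close> in \<open>\<Bbbk>((z\<^bsup>1/p\<^esup>))\<close> involves the choice of
  \<open>\<tau> = \<theta>\<^bsup>1/q\<^esup>\<close>, a series in \<open>z\<^bsup>1/p\<^esup>\<close> without constant term, that is substituted into the left-hand
  side, a series in \<open>\<theta>\<^bsup>1/q\<^esup>\<close>; on the right, \<open>z = (z\<^bsup>1/p\<^esup>)\<^sup>p\<close>.
\<close>

definition solves_system ::
  "nat \<Rightarrow> nat \<Rightarrow> 'k::field_char_0 \<Rightarrow> 'k fls \<Rightarrow> 'k fls \<Rightarrow> bool" where
  "solves_system p q a g f \<longleftrightarrow>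
     (\<exists>\<tau>. fps_nth \<tau> 0 = 0 \<and>
          fls_compose_fps
            (g + fls_const (a * (of_nat (p + q) / of_nat (2 * q))) * fls_X ^ (q + p)) \<tau> = fls_X ^ p \<and>
          f = - inverse (fps_to_fls \<tau> ^ q))"

unbundle no fps_syntax

end

theory Submission
  imports Defs
begin

text \<open>
  Put \<open>t = \<theta>\<^bsup>1/q\<^esup>\<close>, \<open>s = z\<^bsup>1/p\<^esup>\<close> and \<open>\<Phi> v = g \<phi>(v)\<close> on \<open>\<Bbbk>((t))\<close>.  As \<open>\<nabla> = - (\<theta> \<Phi>)\<^sup>-\<^sup>1\<close> means \<open>z \<nabla> = - \<theta>\<^sup>-\<^sup>1\<close>, an
  isomorphism of \<open>E\<^sub>f\<close> with the inverse Mellin transform of \<open>D\<^sub>g\<close> is a bijection \<open>T : \<Bbbk>((s)) \<rightarrow> \<Bbbk>((t))\<close>,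
  continuous in both directions, with
  \<open>T(s\<^sup>p h) = \<Phi>(T h)\<close> and \<open>T((s/p) h' + f h) = - t\<^bsup>-q\<^esup> T h\<close>.

  Such a \<open>T\<close> is sought in the form \<open>T(s\<^sup>n) = b\<^sup>n \<Sum>\<^sub>j P\<^sub>j(n) t\<^bsup>n+j\<^esup>\<close> with \<open>b\<^sup>p = a\<close> and polynomials \<open>P\<^sub>j\<close>.  The first
  equation becomes \<open>P\<^sub>j(n+p) - P\<^sub>j(n) = R\<^sub>j(n)\<close> with a polynomial \<open>R\<^sub>j\<close> that depends on the earlier \<open>P\<^sub>i\<close>, and is
  solvable in characteristic zero (\<open>intertwiner_exists\<close>).  Since a periodic polynomial is constant, a
  family of this form that \<open>\<Phi>\<close> shifts by \<open>p\<close> is determined by its member at \<open>n = 0\<close>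
  (\<open>intertwined_family_vanishes\<close>).  This principle is used twice.  It shows that \<open>T\<close> satisfies the second
  equation for the series \<open>f'\<close> with \<open>T f' = - t\<^bsup>-q\<^esup>\<close>, since that equation then holds at \<open>n = 0\<close>
  (\<open>intertwiner_connection\<close>).  And it computes \<open>T\<close> to the precision that matters: if \<open>\<tau>\<close> solves the first
  equation of the system and \<open>\<sigma>\<close> is its compositional inverse, so that \<open>\<sigma>\<^sup>p = g + a (p+q)/(2q) t\<^bsup>p+q\<^esup>\<close>, then
  \<open>T(s\<^sup>n) = \<sigma>\<^sup>n - b\<^sup>n n(n+q)/(2pq) t\<^bsup>n+q\<^esup>\<close> modulo \<open>t\<^bsup>n+q+1\<^esup>\<close> (\<open>intertwiner_second_order\<close>).  The correction vanishes
  at \<open>n = -q\<close>, the order of \<open>f = - \<tau>\<^bsup>-q\<^esup>\<close>, so \<open>T f = f \<circ> \<sigma> = - t\<^bsup>-q\<^esup>\<close> modulo \<open>t \<Bbbk>[[t]]\<close>.  Therefore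
  \<open>f' - f\<close> lies in \<open>s \<Bbbk>[[s]]\<close>, and multiplication by an exponential turns \<open>f'\<close> into \<open>f\<close>
  (\<open>intertwiner_solution\<close>).

  As \<open>T\<close> preserves orders, it carries the \<open>\<Bbbk>((z))\<close>-structure and the adic topology of \<open>E\<^sub>f\<close> to \<open>\<Bbbk>((t))\<close>, where
  continuity makes the action of \<open>\<Bbbk>((z))\<close> unique (\<open>z_action_unique\<close>).  The solutions \<open>\<tau>\<close> are the inverses of the
  \<open>p\<close>-th roots of the left-hand side, whence existence and uniqueness up to the Galois group.  Finally, a
  root of unity that witnesses lower ramification of \<open>f\<close> acts on \<open>\<tau>\<close>, hence on \<open>g\<close>, to relative order \<open>q\<close>, so
  that the class of \<open>g\<close> would not be minimal either (\<open>solution_in_R_circ\<close>).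
\<close>

unbundle fps_syntax

section \<open>Filtered linear maps between fields of Laurent series\<close>

text \<open>
  Order at least \<open>N\<close>, with the convention that \<open>0\<close> has infinite order; \<^const>\<open>fls_subdegree\<close> assigns it
  the order \<open>0\<close>.
\<close>

definition ord_ge :: "int \<Rightarrow> 'k::zero fls \<Rightarrow> bool" where
  "ord_ge N v \<longleftrightarrow> (\<forall>i<N. v $$ i = 0)"

lemma ord_geD: "ord_ge N v \<Longrightarrow> i < N \<Longrightarrow> v $$ i = 0"
  by (simp add: ord_ge_def)

lemma ord_ge_mono: "ord_ge N v \<Longrightarrow> M \<le> N \<Longrightarrow> ord_ge M v"
  by (simp add: ord_ge_def)

lemma ord_ge_add: "ord_ge N v \<Longrightarrow> ord_ge N w \<Longrightarrow> ord_ge N (v + w)"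
  and ord_ge_diff: "ord_ge N v \<Longrightarrow> ord_ge N w \<Longrightarrow> ord_ge N (v - w)"
  for v w :: "'k::group_add fls"
  by (simp_all add: ord_ge_def)

lemma ord_ge_subdegree: "ord_ge (fls_subdegree v) v"
  by (simp add: ord_ge_def)

lemma ord_ge_iff: "ord_ge N v \<longleftrightarrow> v = 0 \<or> N \<le> fls_subdegree v"
proof
  assume "ord_ge N v"
  then show "v = 0 \<or> N \<le> fls_subdegree v"
    using nth_fls_subdegree_nonzero[of v] by (force simp: ord_ge_def)
qed (auto simp: ord_ge_def)

lemma ord_ge_obtain_fps:
  fixes v :: "'k::comm_ring_1 fls"
  assumes "ord_ge N v"
  obtains r where "v = fls_X_intpow N * fps_to_fls r"
proof
  show "v = fls_X_intpow N * fps_to_fls (Abs_fps (\<lambda>n. v $$ (int n + N)))"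
    using assms by (intro fls_eqI) (auto simp: fls_X_intpow_times_conv_shift ord_ge_def)
qed

lemma ord_ge_X_intpow_mult:
  "ord_ge (N + M) (fls_X_intpow N * v) \<longleftrightarrow> ord_ge M v" for v :: "'k::comm_ring_1 fls"
proof -
  have "(\<forall>i<N + M. v $$ (i - N) = 0) \<longleftrightarrow> (\<forall>i<M. v $$ i = 0)"
  proof safe
    fix i assume *: "\<forall>i<N + M. v $$ (i - N) = 0" "i < M"
    show "v $$ i = 0" using *(1)[rule_format, of "i + N"] *(2) by simp
  qed auto
  then show ?thesis by (simp add: fls_X_intpow_times_conv_shift ord_ge_def)
qed

lemma ord_ge_fps: "ord_ge 0 (fps_to_fls r)"
  by (simp add: ord_ge_def)

lemma ord_ge_mult:
  fixes v w :: "'k::idom fls"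
  shows "ord_ge N v \<Longrightarrow> ord_ge M w \<Longrightarrow> ord_ge (N + M) (v * w)"
  by (cases "v = 0 \<or> w = 0") (auto simp: ord_ge_iff)

lemma ord_ge_fls_X_intpow: "ord_ge n (fls_X_intpow n)"
  by (simp add: ord_ge_def)

lemma fls_sum_nth: "(\<Sum>i\<in>A. F i) $$ n = (\<Sum>i\<in>A. F i $$ n)" for F :: "'i \<Rightarrow> 'k::comm_monoid_add fls"
  by (induction A rule: infinite_finite_induct) auto

text \<open>
  The operators in play (multiplications, substitutions, \<open>s d/ds\<close>, the intertwiner itself) are
  \<open>\<Bbbk>\<close>-linear and raise the order by at least a fixed \<open>d\<close>.  That makes them continuous.
\<close>

locale filtered_map =
  fixes F :: "'k::field fls \<Rightarrow> 'k fls" and d :: int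
  assumes add: "F (v + w) = F v + F w"
    and const_mult: "F (fls_const c * v) = fls_const c * F v"
    and ord: "ord_ge N v \<Longrightarrow> ord_ge (N + d) (F v)"
begin

lemma zero: "F 0 = 0"
  using const_mult[of 0 0] by simp

lemma diff: "F (v - w) = F v - F w"
  using add[of "v - w" w] by simp

lemma sum: "F (\<Sum>i\<in>A. f i) = (\<Sum>i\<in>A. F (f i))"
  by (induction A rule: infinite_finite_induct) (auto simp: zero add)

text \<open>
  By continuity a filtered map commutes with \<open>v = \<Sum>\<^sub>n v\<^sub>n X\<^sup>n\<close>, and only finitely many terms reach a given
  coefficient.
\<close>

lemma expand:
  assumes "ord_ge N v"
  shows "F v $$ m = (\<Sum>n\<in>{N..m - d}. v $$ n * F (fls_X_intpow n) $$ m)"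
proof -
  define P where "P = (\<Sum>n\<in>{N..m - d}. fls_const (v $$ n) * fls_X_intpow n)"
  have P: "P $$ i = (if i \<in> {N..m - d} then v $$ i else 0)" for i
  proof -
    have "P $$ i = (\<Sum>n\<in>{N..m - d}. if n = i then v $$ n else 0)"
      unfolding P_def fls_sum_nth by (intro sum.cong) auto
    then show ?thesis by simp
  qed
  \<comment> \<open>The part of \<open>v\<close> above degree \<open>m - d\<close> cannot contribute to the coefficient at \<open>m\<close>.\<close>
  have "ord_ge (m - d + 1) (v - P)"
    using assms by (auto simp: ord_ge_def P)
  then have "ord_ge (m + 1) (F v - F P)" using ord[of "m - d + 1" "v - P"] by (simp add: diff)
  then have "F v $$ m = F P $$ m" by (auto simp: ord_ge_def)
  also have "\<dots> = (\<Sum>n\<in>{N..m - d}. v $$ n * F (fls_X_intpow n) $$ m)"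
    unfolding P_def sum const_mult fls_sum_nth by simp
  finally show ?thesis .
qed

lemma improve_degree:
  assumes "\<And>n. ord_ge (n + e) (F (fls_X_intpow n))"
  shows "filtered_map F e"
proof
  fix N and v :: "'k fls"
  assume N: "ord_ge N v"
  show "ord_ge (N + e) (F v)"
    unfolding ord_ge_def
  proof (intro allI impI)
    fix m assume "m < N + e"
    then show "F v $$ m = 0"
      unfolding expand[OF N] by (intro sum.neutral) (use assms in \<open>auto simp: ord_ge_def\<close>)
  qed
qed (simp_all add: add const_mult)

end

lemma filtered_map_eqI:
  assumes "filtered_map F d" "filtered_map G e"
    and "\<And>n. F (fls_X_intpow n) = G (fls_X_intpow n)"
  shows "F v = G v"
proof (rule fls_eqI)
  fix m
  interpret F: filtered_map F d by fact
  interpret G: filtered_map G e by fact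
  interpret F': filtered_map F "min d e"
    by unfold_locales (auto simp: F.add F.const_mult intro: ord_ge_mono[OF F.ord])
  interpret G': filtered_map G "min d e"
    by unfold_locales (auto simp: G.add G.const_mult intro: ord_ge_mono[OF G.ord])
  show "F v $$ m = G v $$ m"
    using F'.expand[OF ord_ge_subdegree, of v m] G'.expand[OF ord_ge_subdegree, of v m] assms(3) by simp
qed

lemma filtered_map_compose:
  assumes "filtered_map F d" "filtered_map G e"
  shows "filtered_map (\<lambda>v. F (G v)) (e + d)"
proof -
  interpret F: filtered_map F d by fact
  interpret G: filtered_map G e by fact
  show ?thesis
    by unfold_locales (auto simp: F.add F.const_mult G.add G.const_mult add.assoc[symmetric] intro!: F.ord G.ord)
qed

lemma filtered_map_add:
  assumes "filtered_map F d" "filtered_map G d"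
  shows "filtered_map (\<lambda>v. F v + G v) d"
proof -
  interpret F: filtered_map F d by fact
  interpret G: filtered_map G d by fact
  show ?thesis
    by unfold_locales (auto simp: F.add F.const_mult G.add G.const_mult ring_distribs intro!: F.ord G.ord ord_ge_add)
qed

lemma filtered_map_diff:
  assumes "filtered_map F d" "filtered_map G d"
  shows "filtered_map (\<lambda>v. F v - G v) d"
proof -
  interpret F: filtered_map F d by fact
  interpret G: filtered_map G d by fact
  show ?thesis
    by unfold_locales (auto simp: F.add F.const_mult G.add G.const_mult ring_distribs intro!: F.ord G.ord ord_ge_diff)
qed

lemma filtered_map_mult:
  "ord_ge d g \<Longrightarrow> filtered_map (\<lambda>v. g * v) d"
  by unfold_locales (auto simp: algebra_simps intro: ord_ge_mult)

lemma filtered_map_id: "filtered_map (\<lambda>v. v) 0"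
  by unfold_locales auto

text \<open>
  Conversely, the images \<open>\<Sum>\<^sub>j K n j X\<^bsup>n+j\<^esup>\<close> of the monomials \<open>X\<^sup>n\<close> may be prescribed freely: each coefficient
  of the extended map is a finite sum.
\<close>

lemma filtered_map_exists:
  fixes K :: "int \<Rightarrow> nat \<Rightarrow> 'k::field"
  shows "\<exists>F. filtered_map F 0 \<and> (\<forall>n i. F (fls_X_intpow n) $$ i = (if i < n then 0 else K n (nat (i - n))))"
proof -
  define C where "C v m = (\<Sum>n\<in>{fls_subdegree v..m}. v $$ n * K n (nat (m - n)))" for v m
  have C: "C v m = (\<Sum>n\<in>{N..m}. v $$ n * K n (nat (m - n)))" if "ord_ge N v" for v :: "'k fls" and N m
  proof (cases "v = 0")
    case False
    then have "N \<le> fls_subdegree v" using that by (simp add: ord_ge_iff)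
    then show ?thesis unfolding C_def by (intro sum.mono_neutral_left) auto
  qed (simp add: C_def)
  define F where "F v = Abs_fls (C v)" for v
  have F: "F v $$ m = C v m" for v m
    unfolding F_def by (rule nth_Abs_fls_lower_bound[of "fls_subdegree v"]) (simp add: C_def)
  have "filtered_map F 0"
  proof
    fix v w :: "'k fls"
    define N where "N = min (fls_subdegree v) (fls_subdegree w)"
    have N: "ord_ge N v" "ord_ge N w" unfolding N_def by (meson ord_ge_mono ord_ge_subdegree min.cobounded1 min.cobounded2)+
    show "F (v + w) = F v + F w"
      by (rule fls_eqI) (simp add: F C[OF N(1)] C[OF N(2)] C[OF ord_ge_add[OF N]] distrib_right sum.distrib)
  next
    fix c and v :: "'k fls"
    have "ord_ge (fls_subdegree v) (fls_const c * v)" by (simp add: ord_ge_def)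
    from C[OF this] show "F (fls_const c * v) = fls_const c * F v"
      by (intro fls_eqI) (simp add: F C_def sum_distrib_left mult.assoc)
  next
    fix N and v :: "'k fls"
    assume "ord_ge N v"
    then show "ord_ge (N + 0) (F v)" unfolding ord_ge_def[of _ "F v"] F C[OF \<open>ord_ge N v\<close>] by simp
  qed
  moreover have "F (fls_X_intpow n) $$ i = (if i < n then 0 else K n (nat (i - n)))" for n i
  proof -
    have "F (fls_X_intpow n) $$ i = (\<Sum>m\<in>{n..i}. if m = n then K m (nat (i - m)) else 0)"
      unfolding F C[OF ord_ge_fls_X_intpow] by (intro sum.cong) auto
    then show ?thesis by auto
  qed
  ultimately show ?thesis by blast
qed

text \<open>A filtered map that is invertible on leading terms is invertible, by successive approximation.\<close>

lemma filtered_map_bijective: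
  assumes "filtered_map F 0" and lead: "\<And>n. F (fls_X_intpow n) $$ n \<noteq> 0"
  shows "bij F" and "ord_ge N (F v) \<longleftrightarrow> ord_ge N v"
proof -
  interpret filtered_map F 0 by fact
  have ord_iff: "ord_ge N (F v) \<longleftrightarrow> ord_ge N v" for N v
  proof
    assume N: "ord_ge N (F v)"
    show "ord_ge N v"
    proof (rule ccontr)
      assume *: "\<not> ord_ge N v"
      then have v: "v \<noteq> 0" "fls_subdegree v < N" by (auto simp: ord_ge_iff)
      have "F v $$ fls_subdegree v = v $$ fls_subdegree v * F (fls_X_intpow (fls_subdegree v)) $$ fls_subdegree v"
        by (subst expand[OF ord_ge_subdegree]) simp
      also have "\<dots> \<noteq> 0" using v lead by simp
      finally show False using N v by (auto simp: ord_ge_def)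
    qed
  qed (use ord[of N v] in simp)
  then show "ord_ge N (F v) \<longleftrightarrow> ord_ge N v" .
  have "inj F"
  proof (rule injI)
    fix v w assume "F v = F w"
    then have "F (v - w) = 0" by (simp add: diff)
    then have "ord_ge N (v - w)" for N using ord_iff[of N "v - w"] by (simp add: ord_ge_def)
    then have "(v - w) $$ i = 0" for i using ord_geD[of "i + 1" "v - w" i] by simp
    then show "v = w" by (simp add: fls_eq_iff)
  qed
  moreover have "\<exists>v. F v = w" for w
  proof -
    define N where "N = fls_subdegree w"
    let ?P = "\<lambda>h i x. w $$ (N + int i) =
        (\<Sum>j<i. h j * F (fls_X_intpow (N + int j)) $$ (N + int i)) + x * F (fls_X_intpow (N + int i)) $$ (N + int i)"
    \<comment> \<open>The coefficients \<open>h i\<close> of a preimage of \<open>w\<close>, solved for one after the other.\<close>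
    have "\<exists>h. \<forall>i. ?P h i (h i)"
    proof (rule dependent_wf_choice[OF wf_less_than])
      fix h and i :: nat
      show "\<exists>x. ?P h i x"
        using lead[of "N + int i"] by (intro exI[of _ "(w $$ (N + int i) -
          (\<Sum>j<i. h j * F (fls_X_intpow (N + int j)) $$ (N + int i))) / F (fls_X_intpow (N + int i)) $$ (N + int i)"]) simp
    qed simp
    then obtain h where h: "\<And>i. ?P h i (h i)" by blast
    define v where "v = fls_X_intpow N * fps_to_fls (Abs_fps h)"
    have v: "v $$ (N + int j) = h j" for j
      by (simp add: v_def fls_X_intpow_times_conv_shift)
    have N: "ord_ge N v"
      by (simp add: v_def fls_X_intpow_times_conv_shift ord_ge_def)
    have "F v $$ m = w $$ m" for m
    proof (cases "m < N")
      case True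
      then show ?thesis using ord[OF N] by (simp add: ord_ge_def N_def)
    next
      case False
      then obtain i where m: "m = N + int i" by (meson linorder_not_le zle_iff_zadd)
      have "{N..m} = (\<lambda>j. N + int j) ` {..i}"
      proof safe
        fix n assume "n \<in> {N..m}"
        then show "n \<in> (\<lambda>j. N + int j) ` {..i}" using m by (intro image_eqI[of _ _ "nat (n - N)"]) auto
      qed (auto simp: m)
      then have "F v $$ m = (\<Sum>j\<le>i. h j * F (fls_X_intpow (N + int j)) $$ (N + int i))"
        unfolding expand[OF N] by (simp add: sum.reindex inj_on_def v m)
      also have "\<dots> = w $$ m" unfolding m h[of i] by (simp add: lessThan_Suc_atMost[symmetric])
      finally show ?thesis .
    qed
    then show ?thesis by (auto intro!: exI[of _ v] fls_eqI)
  qed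
  ultimately show "bij F" by (metis bij_def surj_def)
qed

section \<open>Polynomial sequences and their antidifferences\<close>

text \<open>
  Sequences \<open>n \<mapsto> P(n)\<close> on the integers with \<open>P\<close> a polynomial.  Polynomiality is what makes the difference
  equations below have unique solutions: an arbitrary function on \<open>\<int>\<close> may be \<open>p\<close>-periodic without being
  constant.
\<close>

definition poly_seq :: "(int \<Rightarrow> 'k::field_char_0) \<Rightarrow> bool" where
  "poly_seq F \<longleftrightarrow> (\<exists>P. \<forall>n. F n = poly P (of_int n))"

lemma poly_seq_const [intro]: "poly_seq (\<lambda>_. c)"
  by (auto simp: poly_seq_def intro!: exI[of _ "[:c:]"])

lemma poly_seq_of_int [intro]: "poly_seq of_int"
  unfolding poly_seq_def by (rule exI[of _ "[:0, 1:]"]) simp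

lemma poly_seq_add [intro]: "poly_seq F \<Longrightarrow> poly_seq G \<Longrightarrow> poly_seq (\<lambda>n. F n + G n)"
  unfolding poly_seq_def by (metis poly_add)

lemma poly_seq_diff [intro]: "poly_seq F \<Longrightarrow> poly_seq G \<Longrightarrow> poly_seq (\<lambda>n. F n - G n)"
  unfolding poly_seq_def by (metis poly_diff)

lemma poly_seq_mult [intro]: "poly_seq F \<Longrightarrow> poly_seq G \<Longrightarrow> poly_seq (\<lambda>n. F n * G n)"
  unfolding poly_seq_def by (metis poly_mult)

lemma poly_seq_sum [intro]:
  "(\<And>i. i \<in> A \<Longrightarrow> poly_seq (F i)) \<Longrightarrow> poly_seq (\<lambda>n. \<Sum>i\<in>A. F i n)"
  by (induction A rule: infinite_finite_induct) auto

lemma poly_seq_prod [intro]: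
  "(\<And>i. i \<in> A \<Longrightarrow> poly_seq (F i)) \<Longrightarrow> poly_seq (\<lambda>n. \<Prod>i\<in>A. F i n)"
  by (induction A rule: infinite_finite_induct) auto

lemma poly_seq_power [intro]: "poly_seq F \<Longrightarrow> poly_seq (\<lambda>n. F n ^ k)"
  by (induction k) auto

lemma poly_seq_shift:
  assumes "poly_seq F"
  shows "poly_seq (\<lambda>n. F (n + m))"
proof -
  obtain P where "\<And>n. F n = poly P (of_int n)" using assms by (auto simp: poly_seq_def)
  then show ?thesis unfolding poly_seq_def
    by (intro exI[of _ "pcompose P [:of_int m, 1:]"]) (simp add: poly_pcompose add.commute)
qed

lemma poly_seq_gbinomial:
  assumes "poly_seq F"
  shows "poly_seq (\<lambda>n. F n gchoose k)"
proof -
  have "(\<lambda>n. F n gchoose k) = (\<lambda>n. (\<Prod>i = 0..<k. F n - of_nat i) * (1 / fact k))"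
    by (simp add: gbinomial_prod_rev)
  moreover have "poly_seq (\<lambda>n. (\<Prod>i = 0..<k. F n - of_nat i) * (1 / fact k))"
    using assms by (intro poly_seq_prod poly_seq_mult poly_seq_diff poly_seq_const)
  ultimately show ?thesis by simp
qed

text \<open>
  \<open>P - P(0)\<close> has the infinitely many zeros \<open>0, p, 2p, \<dots>\<close>; they are distinct in characteristic zero.
\<close>

lemma periodic_poly_seq_const:
  assumes "poly_seq F" and "p > 0" and "\<And>n. F (n + int p) = F n"
  shows "F n = F 0"
proof -
  obtain P where P: "\<And>n. F n = poly P (of_int n)" using assms(1) by (auto simp: poly_seq_def)
  have mult: "F (int p * int k) = F 0" for k
    using assms(3)[of "int p * int k" for k] by (induction k) (simp_all add: algebra_simps)
  have "P - [:F 0:] = 0"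
  proof (rule ccontr)
    assume "P - [:F 0:] \<noteq> 0"
    then have "finite {x. poly (P - [:F 0:]) x = 0}" by (rule poly_roots_finite)
    moreover have "range (\<lambda>k. of_nat (p * k)) \<subseteq> {x. poly (P - [:F 0:]) x = 0}"
      using mult P by auto
    moreover have "infinite (range (\<lambda>k. of_nat (p * k) :: 'a))"
      using \<open>p > 0\<close> by (intro range_inj_infinite) (auto simp: inj_on_def simp del: of_nat_mult)
    ultimately show False using finite_subset by blast
  qed
  then show ?thesis using P[of n] by simp
qed

text \<open>
  By the binomial theorem the difference of \<open>n\<^bsup>d+1\<^esup>\<close> is \<open>(d+1) p n\<^sup>d\<close> plus lower powers of \<open>n\<close>, which have
  antidifferences by induction; characteristic zero allows division by \<open>(d+1) p\<close>.
\<close>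

lemma antidifference_power:
  assumes p: "p > 0"
  shows "\<exists>Q. poly_seq Q \<and> (\<forall>n. Q (n + int p) - Q n = (of_int n :: 'k::field_char_0) ^ d)"
proof (induction d rule: less_induct)
  case (less d)
  have "\<forall>k. \<exists>Q. k < d \<longrightarrow> poly_seq Q \<and> (\<forall>n. Q (n + int p) - Q n = (of_int n :: 'k) ^ k)"
    using less by blast
  then obtain Q where Q: "\<And>k. k < d \<Longrightarrow> poly_seq (Q k)"
    "\<And>k n. k < d \<Longrightarrow> Q k (n + int p) - Q k n = (of_int n :: 'k) ^ k" by metis
  define c where "c k = of_nat (Suc d choose k) * (of_nat p :: 'k) ^ (Suc d - k)" for k
  have cd: "c d \<noteq> 0" using p by (simp add: c_def del: of_nat_Suc)
  have step: "of_int (n + int p) ^ Suc d - of_int n ^ Suc d = c d * of_int n ^ d + (\<Sum>k<d. c k * (of_int n :: 'k) ^ k)" for n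
  proof -
    have "(of_int (n + int p) :: 'k) ^ Suc d = (\<Sum>k\<le>Suc d. c k * of_int n ^ k)"
      by (simp only: of_int_add of_int_of_nat_eq binomial_ring) (simp add: c_def mult_ac)
    also have "\<dots> = of_int n ^ Suc d + (c d * of_int n ^ d + (\<Sum>k<d. c k * (of_int n :: 'k) ^ k))"
      by (simp add: lessThan_Suc_atMost[symmetric] c_def)
    finally show ?thesis by simp
  qed
  define R where "R n = (1 / c d) * (of_int n ^ Suc d - (\<Sum>k<d. c k * Q k n))" for n
  have "R (n + int p) - R n = of_int n ^ d" for n
  proof -
    have "R (n + int p) - R n = (1 / c d) * ((of_int (n + int p) ^ Suc d - of_int n ^ Suc d)
        - (\<Sum>k<d. c k * (Q k (n + int p) - Q k n)))"
      by (simp add: R_def sum_subtractf algebra_simps)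
    also have "\<dots> = (1 / c d) * (c d * of_int n ^ d)" by (subst step) (simp add: Q)
    finally show ?thesis using cd by simp
  qed
  moreover have "poly_seq R" unfolding R_def
    by (intro poly_seq_mult poly_seq_diff poly_seq_power poly_seq_sum poly_seq_const poly_seq_of_int) (simp add: Q(1))
  ultimately show ?case by blast
qed

lemma antidifference_exists:
  fixes R :: "int \<Rightarrow> 'k::field_char_0"
  assumes p: "p > 0" and R: "poly_seq R"
  shows "\<exists>Q. poly_seq Q \<and> Q 0 = 0 \<and> (\<forall>n. Q (n + int p) - Q n = R n)"
proof -
  obtain P where P: "\<And>n. R n = poly P (of_int n)" using R by (auto simp: poly_seq_def)
  have "\<forall>d. \<exists>Q. poly_seq Q \<and> (\<forall>n. Q (n + int p) - Q n = (of_int n :: 'k) ^ d)"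
    using antidifference_power[OF p] by blast
  then obtain Q where Q: "\<And>d. poly_seq (Q d)" "\<And>d n. Q d (n + int p) - Q d n = (of_int n :: 'k) ^ d"
    by metis
  define S where "S n = (\<Sum>d\<le>degree P. coeff P d * Q d n)" for n
  have "poly_seq S" unfolding S_def by (intro poly_seq_sum poly_seq_mult poly_seq_const Q(1))
  moreover have "S (n + int p) - S n = R n" for n
    by (simp add: S_def P poly_altdef sum_subtractf[symmetric] right_diff_distrib[symmetric] Q)
  ultimately show ?thesis by (intro exI[of _ "\<lambda>n. S n - S 0"]) auto
qed

section \<open>Substitutions\<close>

text \<open>
  The exponent law \<open>((1 + y)\<^sup>a)\<^sup>n = (1 + y)\<^bsup>na\<^esup>\<close>.  Its right-hand side has coefficients that are polynomials in
  \<open>n\<close>, which is how integer powers of series enter the polynomial families below.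
\<close>

lemma fps_binomial_compose_powi:
  fixes y :: "'k::field_char_0 fps"
  assumes y: "y $ 0 = 0"
  shows "fps_to_fls (fps_binomial a oo y) powi n = fps_to_fls (fps_binomial (of_int n * a) oo y)"
proof -
  have nat: "fps_to_fls (fps_binomial a oo y) ^ k = fps_to_fls (fps_binomial (of_nat k * a) oo y)" for k
    by (simp add: fps_binomial_power[symmetric] fps_compose_power[OF y, symmetric] fps_to_fls_power)
  show ?thesis
  proof (cases "n \<ge> 0")
    case True
    then obtain k where "n = int k" by (metis nonneg_int_cases)
    then show ?thesis by (simp add: nat)
  next
    case False
    then obtain k where k: "n = - int k" by (metis int_cases2 of_nat_0_le_iff)
    have "fps_to_fls (fps_binomial (of_nat k * a) oo y) * fps_to_fls (fps_binomial (- (of_nat k * a)) oo y) = 1"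
      using fps_binomial_add_mult[of "of_nat k * a" "- (of_nat k * a)"]
      by (simp add: fls_times_fps_to_fls[symmetric] fps_compose_mult_distrib[OF y, symmetric])
    then have "inverse (fps_to_fls (fps_binomial (of_nat k * a) oo y)) = fps_to_fls (fps_binomial (- (of_nat k * a)) oo y)"
      by (rule inverse_unique)
    then show ?thesis by (simp add: k nat power_int_minus)
  qed
qed

lemma linear_fps_factor:
  fixes \<tau> :: "'k::field_char_0 fps"
  assumes "\<tau> $ 0 = 0" "\<tau> $ 1 \<noteq> 0"
  obtains y where "y $ 0 = 0" "\<tau> = fps_const (\<tau> $ 1) * fps_X * (1 + y)"
proof
  define y where "y = fps_const (1 / \<tau> $ 1) * fps_shift 1 \<tau> - 1"
  show "y $ 0 = 0" using assms by (simp add: y_def)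
  have "fps_const (\<tau> $ 1) * fps_X * (1 + y) = fps_X * fps_shift 1 \<tau>"
    using assms by (simp add: y_def mult_ac fps_const_mult[symmetric] flip: mult.assoc)
  also have "\<dots> = \<tau>" using assms by (intro fps_ext) auto
  finally show "\<tau> = fps_const (\<tau> $ 1) * fps_X * (1 + y)" by simp
qed

lemma fls_X_powi: "(fls_X :: 'k::field fls) powi n = fls_X_intpow n"
  by simp

lemma linear_fps_powi:
  fixes \<tau> y :: "'k::field_char_0 fps"
  assumes "y $ 0 = 0" "\<tau> = fps_const c * fps_X * (1 + y)"
  shows "fps_to_fls \<tau> powi n = fls_X_intpow n * fps_to_fls (fps_const (c powi n) * (fps_binomial (of_int n) oo y))"
proof -
  have "fps_binomial 1 oo y = 1 + y"
    using fps_binomial_of_nat[of 1, where ?'a = 'k] by (simp add: fps_compose_add_distrib assms)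
  then have "fps_to_fls (1 + y) powi n = fps_to_fls (fps_binomial (of_int n) oo y)"
    using fps_binomial_compose_powi[OF assms(1), of 1 n] by simp
  moreover have "fps_to_fls \<tau> = fls_X * (fls_const c * fps_to_fls (1 + y))"
    by (simp add: assms(2) fls_times_fps_to_fls mult_ac)
  ultimately have "fps_to_fls \<tau> powi n = fls_X powi n * (fls_const (c powi n) * fps_to_fls (fps_binomial (of_int n) oo y))"
    by (simp only: power_int_mult_distrib fls_const_power_int)
  then show ?thesis by (simp only: fls_X_powi fls_times_fps_to_fls fps_const_to_fls)
qed

lemma ord_ge_linear_fps_powi:
  fixes \<tau> :: "'k::field_char_0 fps"
  assumes "\<tau> $ 0 = 0" "\<tau> $ 1 \<noteq> 0"
  shows "ord_ge n (fps_to_fls \<tau> powi n)" and "(fps_to_fls \<tau> powi n) $$ n = (\<tau> $ 1) powi n"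
proof -
  obtain y where y: "y $ 0 = 0" "\<tau> = fps_const (\<tau> $ 1) * fps_X * (1 + y)"
    using linear_fps_factor[OF assms] .
  note * = linear_fps_powi[OF y, of n]
  show "ord_ge n (fps_to_fls \<tau> powi n)" "(fps_to_fls \<tau> powi n) $$ n = (\<tau> $ 1) powi n"
    unfolding * by (simp_all add: fls_X_intpow_times_conv_shift ord_ge_def)
qed

lemma linear_fps_powi_poly_seq:
  fixes \<tau> :: "'k::field_char_0 fps"
  assumes "\<tau> $ 0 = 0" "\<tau> $ 1 \<noteq> 0"
  shows "\<exists>Q. poly_seq Q \<and> (\<forall>n. (fps_to_fls \<tau> powi n) $$ (n + int j) = (\<tau> $ 1) powi n * Q n)"
proof -
  obtain y where y: "y $ 0 = 0" "\<tau> = fps_const (\<tau> $ 1) * fps_X * (1 + y)"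
    using linear_fps_factor[OF assms] .
  have "poly_seq (\<lambda>n. (fps_binomial (of_int n) oo y) $ j)"
    unfolding fps_compose_nth fps_binomial_nth by (auto intro!: poly_seq_sum poly_seq_mult poly_seq_gbinomial)
  moreover have "(fps_to_fls \<tau> powi n) $$ (n + int j) = (\<tau> $ 1) powi n * (fps_binomial (of_int n) oo y) $ j" for n
    unfolding linear_fps_powi[OF y, of n]
    by (simp add: fls_X_intpow_times_conv_shift)
  ultimately show ?thesis by blast
qed

lemma filtered_map_compose_fps:
  fixes \<tau> :: "'k::field_char_0 fps"
  assumes "\<tau> $ 0 = 0" "\<tau> $ 1 \<noteq> 0"
  shows "filtered_map (\<lambda>v. fls_compose_fps v \<tau>) 0"
    and "fls_compose_fps (fls_X_intpow n) \<tau> = fps_to_fls \<tau> powi n"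
proof -
  have nz: "\<tau> \<noteq> 0" using assms by auto
  have X: "fls_compose_fps (fls_X_intpow n) \<tau> = fps_to_fls \<tau> powi n" for n
    using fls_compose_fps_powi[of \<tau> fls_X n] assms nz by simp
  show "filtered_map (\<lambda>v. fls_compose_fps v \<tau>) 0"
  proof
    fix N and v :: "'k fls"
    assume "ord_ge N v"
    then obtain r where "v = fls_X_intpow N * fps_to_fls r" by (rule ord_ge_obtain_fps)
    then have "fls_compose_fps v \<tau> = fps_to_fls \<tau> powi N * fps_to_fls (r oo \<tau>)"
      using fls_compose_fps_mult[of \<tau> "fls_X_intpow N" "fps_to_fls r"] X[of N] assms nz by simp
    then show "ord_ge (N + 0) (fls_compose_fps v \<tau>)"
      using ord_ge_mult[OF ord_ge_linear_fps_powi(1)[OF assms] ord_ge_fps] by simp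
  qed (use assms nz in \<open>simp_all add: fls_compose_fps_add fls_compose_fps_mult\<close>)
  show "fls_compose_fps (fls_X_intpow n) \<tau> = fps_to_fls \<tau> powi n" by (rule X)
qed

section \<open>The automorphism \<open>\<phi>\<close>\<close>

context
  fixes q :: nat
  assumes q: "q > 0"
begin

lemma phi_fps_nths:
  "(fps_X * (fps_binomial (- 1 / of_nat q) oo fps_X ^ q) :: 'k::field_char_0 fps) $ 0 = 0"
  "(fps_X * (fps_binomial (- 1 / of_nat q) oo fps_X ^ q) :: 'k::field_char_0 fps) $ 1 \<noteq> 0"
  by simp_all

lemma phi_filtered_map: "filtered_map (phi q :: 'k::field_char_0 fls \<Rightarrow> _) 0"
  using filtered_map_compose_fps(1)[OF phi_fps_nths] unfolding phi_def by simp

lemma phi_mult: "phi q (v * w) = phi q v * phi q (w :: 'k::field_char_0 fls)"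
proof -
  have "(fps_X * (fps_binomial (- 1 / of_nat q) oo fps_X ^ q) :: 'k fps) \<noteq> 0"
    using phi_fps_nths(2) by (metis fps_zero_nth)
  then show ?thesis unfolding phi_def by (intro fls_compose_fps_mult) simp_all
qed

text \<open>
  \<open>\<phi>(t\<^sup>n) = t\<^sup>n (1 + \<theta>)\<^bsup>-n/q\<^esup>\<close>, where \<open>t = \<theta>\<^bsup>1/q\<^esup>\<close>.
\<close>

lemma phi_X_intpow:
  "phi q (fls_X_intpow n :: 'k::field_char_0 fls) =
     fls_X_intpow n * fps_to_fls (fps_binomial (- of_int n / of_nat q) oo fps_X ^ q)"
proof -
  have *: "(fps_X ^ q :: 'k fps) $ 0 = 0" using q by simp
  have "phi q (fls_X_intpow n :: 'k fls) =
    (fls_X * fps_to_fls (fps_binomial (- 1 / of_nat q) oo fps_X ^ q)) powi n"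
    unfolding phi_def using filtered_map_compose_fps(2)[OF phi_fps_nths] by (simp add: fls_times_fps_to_fls)
  also have "\<dots> = fls_X_intpow n * fps_to_fls (fps_binomial (- of_int n / of_nat q) oo fps_X ^ q)"
    using fps_binomial_compose_powi[OF *, of "- 1 / of_nat q" n]
    by (simp only: power_int_mult_distrib fls_X_powi) (simp add: field_simps)
  finally show ?thesis .
qed

lemma phi_X_intpow_nth:
  "phi q (fls_X_intpow n :: 'k::field_char_0 fls) $$ (n + int j) =
     (if q dvd j then - of_int n / of_nat q gchoose (j div q) else 0)"
  unfolding phi_X_intpow using q by (simp add: fls_X_intpow_times_conv_shift fps_nth_compose_X_power)

text \<open>
  In the coordinate \<open>\<theta>\<^sup>-\<^sup>1\<close> the automorphism \<open>\<phi>\<close> is the shift by \<open>1\<close>.  This matches the commutation of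
  \<open>z d/dz\<close> with \<open>z\<close>.
\<close>

lemma phi_theta_inverse:
  "phi q (fls_X_intpow (- int q)) = (fls_X_intpow (- int q) + 1 :: 'k::field_char_0 fls)"
proof -
  have *: "(fps_X ^ q :: 'k fps) $ 0 = 0" using q by simp
  have "fps_binomial (- of_int (- int q) / of_nat q) oo fps_X ^ q = (1 + fps_X ^ q :: 'k fps)"
    using q fps_binomial_of_nat[of 1, where ?'a = 'k] by (simp add: fps_compose_add_distrib)
  then have "phi q (fls_X_intpow (- int q)) = fls_X_intpow (- int q) * (1 + fls_X ^ q :: 'k fls)"
    unfolding phi_X_intpow by (simp add: fps_to_fls_power)
  also have "\<dots> = fls_X_intpow (- int q) + 1"
    using fls_X_intpow_times_fls_X_intpow[of "- int q" "int q", where ?'a = 'k]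
    by (simp add: distrib_left fls_X_power_conv_shift_1)
  finally show ?thesis .
qed

text \<open>
  In relative degree at most \<open>q\<close>, \<open>\<phi>\<close> is \<open>1 - (\<theta>/q) t d/dt\<close>.  All noncommutativity that influences \<open>f\<close>
  modulo \<open>z\<^bsup>1/p\<^esup> \<Bbbk>[[z\<^bsup>1/p\<^esup>]]\<close> is contained in this first-order term.
\<close>

lemma phi_first_order:
  fixes v :: "'k::field_char_0 fls"
  assumes N: "ord_ge N v"
  shows "ord_ge (N + int q + 1) (phi q v - v + fls_const (of_int N / of_nat q * v $$ N) * fls_X_intpow (N + int q))"
proof -
  interpret P: filtered_map "\<lambda>v. phi q v - v :: 'k fls" 0
    by (intro filtered_map_diff phi_filtered_map filtered_map_id)
  have nth: "(phi q (fls_X_intpow n) - fls_X_intpow n :: 'k fls) $$ m =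
      (if m < n + int q then 0 else - of_int n / of_nat q)" if lt: "m < n + int q + 1" for n m
  proof (cases "m < n")
    case True
    interpret f: filtered_map "phi q :: 'k fls \<Rightarrow> _" 0 by (rule phi_filtered_map)
    show ?thesis using True f.ord[OF ord_ge_fls_X_intpow, of n] by (simp add: ord_ge_def)
  next
    case False
    then obtain j where m: "m = n + int j" by (meson linorder_not_le zle_iff_zadd)
    consider "j = 0" | "0 < j" "j < q" | "j = q" using lt m by linarith
    then show ?thesis
    proof cases
      case 2
      then have "\<not> q dvd j" by (auto dest: dvd_imp_le)
      then show ?thesis using 2 phi_X_intpow_nth[of n j] m by simp
    qed (use phi_X_intpow_nth[of n j] m q in auto)
  qed
  have ord: "ord_ge (n + int q) (phi q (fls_X_intpow n) - fls_X_intpow n :: 'k fls)" for n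
    unfolding ord_ge_def
  proof (intro allI impI)
    fix i assume "i < n + int q"
    then show "(phi q (fls_X_intpow n) - fls_X_intpow n :: 'k fls) $$ i = 0" using nth[of i n] by simp
  qed
  interpret P': filtered_map "\<lambda>v. phi q v - v :: 'k fls" "int q"
    by (rule P.improve_degree) (rule ord)
  have "(phi q v - v) $$ m = (if m < N + int q then 0 else - (of_int N / of_nat q * v $$ N))"
    if "m < N + int q + 1" for m
  proof (cases "m < N + int q")
    case True
    then show ?thesis using P'.ord[OF N] by (simp add: ord_ge_def)
  next
    case False
    then have m: "m = N + int q" using that by simp
    show ?thesis using P'.expand[OF N, of m] nth[of m N] by (simp add: m)
  qed
  then show ?thesis by (auto simp: ord_ge_def)
qed

end

section \<open>Families with polynomial coefficients\<close>

text \<open>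
  Families \<open>W\<^sub>n = b\<^sup>n \<Sum>\<^sub>j Q\<^sub>j(n) X\<^bsup>n+j\<^esup>\<close> with polynomials \<open>Q\<^sub>j\<close>.  The images of the monomials \<open>s\<^sup>n\<close>, and everything
  that is built from them, have this form.
\<close>

definition poly_family :: "'k::field_char_0 \<Rightarrow> (int \<Rightarrow> 'k fls) \<Rightarrow> bool" where
  "poly_family b W \<longleftrightarrow> (\<forall>j. \<exists>Q. poly_seq Q \<and> (\<forall>n. W n $$ (n + j) = b powi n * Q n))"

lemma poly_familyD:
  "poly_family b W \<Longrightarrow> \<exists>Q. poly_seq Q \<and> (\<forall>n. W n $$ (n + j) = b powi n * Q n)"
  by (simp add: poly_family_def)

lemma poly_family_add: "poly_family b V \<Longrightarrow> poly_family b W \<Longrightarrow> poly_family b (\<lambda>n. V n + W n)"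
  unfolding poly_family_def
proof
  fix j assume VW: "\<forall>j. \<exists>Q. poly_seq Q \<and> (\<forall>n. V n $$ (n + j) = b powi n * Q n)"
    "\<forall>j. \<exists>Q. poly_seq Q \<and> (\<forall>n. W n $$ (n + j) = b powi n * Q n)"
  obtain P Q where "poly_seq P" "poly_seq Q"
    "\<And>n. V n $$ (n + j) = b powi n * P n" "\<And>n. W n $$ (n + j) = b powi n * Q n"
    using VW by meson
  then show "\<exists>Q. poly_seq Q \<and> (\<forall>n. (V n + W n) $$ (n + j) = b powi n * Q n)"
    by (intro exI[of _ "\<lambda>n. P n + Q n"]) (auto simp: distrib_left)
qed

lemma poly_family_diff: "poly_family b V \<Longrightarrow> poly_family b W \<Longrightarrow> poly_family b (\<lambda>n. V n - W n)"
  unfolding poly_family_def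
proof
  fix j assume VW: "\<forall>j. \<exists>Q. poly_seq Q \<and> (\<forall>n. V n $$ (n + j) = b powi n * Q n)"
    "\<forall>j. \<exists>Q. poly_seq Q \<and> (\<forall>n. W n $$ (n + j) = b powi n * Q n)"
  obtain P Q where "poly_seq P" "poly_seq Q"
    "\<And>n. V n $$ (n + j) = b powi n * P n" "\<And>n. W n $$ (n + j) = b powi n * Q n"
    using VW by meson
  then show "\<exists>Q. poly_seq Q \<and> (\<forall>n. (V n - W n) $$ (n + j) = b powi n * Q n)"
    by (intro exI[of _ "\<lambda>n. P n - Q n"]) (auto simp: right_diff_distrib)
qed

lemma poly_family_scale:
  assumes "poly_seq c" "poly_family b W"
  shows "poly_family b (\<lambda>n. fls_const (c n) * W n)"
  unfolding poly_family_def
proof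
  fix j
  obtain Q where "poly_seq Q" "\<And>n. W n $$ (n + j) = b powi n * Q n"
    using poly_familyD[OF assms(2), of "j"] by blast
  then show "\<exists>Q. poly_seq Q \<and> (\<forall>n. (fls_const (c n) * W n) $$ (n + j) = b powi n * Q n)"
    using assms(1) by (intro exI[of _ "\<lambda>n. c n * Q n"]) (auto simp: mult_ac)
qed

lemma poly_family_X_intpow_mult:
  assumes "poly_family b W"
  shows "poly_family b (\<lambda>n. fls_X_intpow m * W n)"
  unfolding poly_family_def
proof
  fix j
  obtain Q where "poly_seq Q" "\<And>n. W n $$ (n + (j - m)) = b powi n * Q n"
    using poly_familyD[OF assms, of "j - m"] by blast
  then show "\<exists>Q. poly_seq Q \<and> (\<forall>n. (fls_X_intpow m * W n) $$ (n + j) = b powi n * Q n)"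
    by (intro exI[of _ Q]) (auto simp: fls_X_intpow_times_conv_shift algebra_simps)
qed

lemma poly_family_X_intpow:
  assumes "poly_seq c"
  shows "poly_family b (\<lambda>n. fls_const (b powi n * c n) * fls_X_intpow (n + m))"
  unfolding poly_family_def
proof
  fix j
  have "poly_seq (\<lambda>n. if j = m then c n else 0)" using assms by (cases "j = m") auto
  then show "\<exists>Q. poly_seq Q \<and> (\<forall>n. (fls_const (b powi n * c n) * fls_X_intpow (n + m)) $$ (n + j) = b powi n * Q n)"
    by (intro exI[of _ "\<lambda>n. if j = m then c n else 0"]) auto
qed

lemma poly_family_linear_fps_powi:
  fixes \<tau> :: "'k::field_char_0 fps"
  assumes "\<tau> $ 0 = 0" "\<tau> $ 1 \<noteq> 0"
  shows "poly_family (\<tau> $ 1) (\<lambda>n. fps_to_fls \<tau> powi n)"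
  unfolding poly_family_def
proof
  fix j :: int
  show "\<exists>Q. poly_seq Q \<and> (\<forall>n. (fps_to_fls \<tau> powi n) $$ (n + j) = (\<tau> $ 1) powi n * Q n)"
  proof (cases "j < 0")
    case True
    then show ?thesis using ord_ge_linear_fps_powi(1)[OF assms] 
      by (intro exI[of _ "\<lambda>_. 0"]) (auto simp: ord_ge_def)
  next
    case False
    then show ?thesis using linear_fps_powi_poly_seq[OF assms, of "nat j"] by simp
  qed
qed

lemma poly_family_image_mult:
  assumes "filtered_map T 0" and b: "b \<noteq> 0" and fam: "poly_family b (\<lambda>n. T (fls_X_intpow n))"
  shows "poly_family b (\<lambda>n. T (v * fls_X_intpow n))"
  unfolding poly_family_def
proof
  fix j
  interpret filtered_map T 0 by fact
  define N where "N = fls_subdegree v"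
  have "\<forall>i. \<exists>Q. poly_seq Q \<and> (\<forall>n. T (fls_X_intpow n) $$ (n + (j - i)) = b powi n * Q n)"
    using fam unfolding poly_family_def by blast
  then obtain Q where Q: "\<And>i. poly_seq (Q i)"
    "\<And>i n. T (fls_X_intpow n) $$ (n + (j - i)) = b powi n * Q i n" by metis
  have "T (v * fls_X_intpow n) $$ (n + j) = b powi n * (\<Sum>i\<in>{N..j}. v $$ i * b powi i * Q i (n + i))" for n
  proof -
    have "ord_ge (N + n) (v * fls_X_intpow n)"
      unfolding N_def by (rule ord_ge_mult[OF ord_ge_subdegree ord_ge_fls_X_intpow])
    from expand[OF this, of "n + j"]
    have "T (v * fls_X_intpow n) $$ (n + j) =
        (\<Sum>k\<in>{N + n..n + j}. v $$ (k - n) * T (fls_X_intpow k) $$ (n + j))"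
      by (simp add: fls_X_intpow_times_comm[symmetric] fls_X_intpow_times_conv_shift)
    also have "\<dots> = (\<Sum>i\<in>{N..j}. v $$ i * T (fls_X_intpow (n + i)) $$ (n + j))"
      by (rule sum.reindex_bij_witness[of _ "\<lambda>i. n + i" "\<lambda>k. k - n"]) auto
    also have "\<dots> = (\<Sum>i\<in>{N..j}. b powi n * (v $$ i * b powi i * Q i (n + i)))"
    proof (rule sum.cong[OF refl])
      fix i
      show "v $$ i * T (fls_X_intpow (n + i)) $$ (n + j) = b powi n * (v $$ i * b powi i * Q i (n + i))"
        using Q(2)[of "n + i" i] b by (simp add: power_int_add)
    qed
    finally show ?thesis by (simp add: sum_distrib_left)
  qed
  moreover have "poly_seq (\<lambda>n. \<Sum>i\<in>{N..j}. v $$ i * b powi i * Q i (n + i))"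
    by (intro poly_seq_sum poly_seq_mult poly_seq_const poly_seq_shift Q(1))
  ultimately show "\<exists>Q. poly_seq Q \<and> (\<forall>n. T (v * fls_X_intpow n) $$ (n + j) = b powi n * Q n)"
    by (intro exI[of _ "\<lambda>n. \<Sum>i\<in>{N..j}. v $$ i * b powi i * Q i (n + i)"]) auto
qed

section \<open>The intertwining operator\<close>

text \<open>
  \<open>b\<close> is a \<open>p\<close>-th root of the leading coefficient of \<open>g\<close>; it is the leading coefficient of \<open>z\<^bsup>1/p\<^esup>\<close> as a series
  in \<open>t = \<theta>\<^bsup>1/q\<^esup>\<close>.
\<close>

locale difference_operator =
  fixes p q :: nat and g :: "'k::field_char_0 fls" and b :: 'k
  assumes p: "p > 0" and q: "q > 0" and b: "b \<noteq> 0"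
    and g_ord: "ord_ge (int p) g" and g_lead: "g $$ int p = b ^ p"
begin

definition Phi :: "'k fls \<Rightarrow> 'k fls" where
  "Phi v = g * phi q v"

sublocale Phi: filtered_map Phi "int p"
  using filtered_map_compose[OF filtered_map_mult[OF g_ord] phi_filtered_map[OF q]]
  unfolding Phi_def by simp

lemma b_powi_add: "b powi (n + int p) = b powi n * b ^ p"
  using b by (simp add: power_int_add)

lemma Phi_theta_inverse: "Phi (fls_X_intpow (- int q) * v) = (fls_X_intpow (- int q) + 1) * Phi v"
  by (simp only: Phi_def phi_mult[OF q] phi_theta_inverse[OF q] mult_ac)

lemma Phi_X_intpow:
  obtains G where "G $ 0 = b ^ p"
    "\<And>n. Phi (fls_X_intpow n) =
       fls_X_intpow (n + int p) * fps_to_fls (G * (fps_binomial (- of_int n / of_nat q) oo fps_X ^ q))"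
proof -
  obtain G where G: "g = fls_X_intpow (int p) * fps_to_fls G" using g_ord by (rule ord_ge_obtain_fps)
  have "G $ 0 = b ^ p" using g_lead by (simp add: G fls_X_intpow_times_conv_shift)
  moreover have "Phi (fls_X_intpow n) =
      fls_X_intpow (n + int p) * fps_to_fls (G * (fps_binomial (- of_int n / of_nat q) oo fps_X ^ q))" for n
    unfolding Phi_def phi_X_intpow[OF q] fls_X_intpow_times_fls_X_intpow[symmetric] fls_times_fps_to_fls
    unfolding G by (simp only: mult_ac)
  ultimately show thesis by (rule that)
qed

lemma Phi_X_intpow_poly_seq: "poly_seq (\<lambda>n. Phi (fls_X_intpow n) $$ (n + int p + int i))"
proof -
  obtain G where G: "\<And>n. Phi (fls_X_intpow n) =
       fls_X_intpow (n + int p) * fps_to_fls (G * (fps_binomial (- of_int n / of_nat q) oo fps_X ^ q))"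
    using Phi_X_intpow by metis
  have "poly_seq (\<lambda>n. (fps_binomial (- of_int n / of_nat q) oo fps_X ^ q) $ k :: 'k)" for k
  proof (cases "q dvd k")
    case True
    have "poly_seq (\<lambda>n. (- 1 / of_nat q) * of_int n gchoose (k div q) :: 'k)"
      by (intro poly_seq_gbinomial poly_seq_mult poly_seq_const poly_seq_of_int)
    then show ?thesis using True q by (simp add: fps_nth_compose_X_power)
  qed (use q in \<open>simp add: fps_nth_compose_X_power poly_seq_const\<close>)
  then show ?thesis unfolding G fls_X_intpow_times_conv_shift
    by (simp add: fps_mult_nth) (intro poly_seq_sum poly_seq_mult poly_seq_const)
qed

lemma Phi_lead:
  assumes "ord_ge n v"
  shows "Phi v $$ (n + int p) = b ^ p * v $$ n"
proof -
  have "Phi (fls_X_intpow n) $$ (n + int p) = b ^ p"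
    by (rule Phi_X_intpow) (simp only: fls_X_intpow_times_conv_shift, simp)
  then show ?thesis by (simp add: Phi.expand[OF assms])
qed

text \<open>
  The uniqueness principle.  If \<open>W\<^bsub>n+p\<^esub> = \<Phi> W\<^sub>n\<close> holds to relative order \<open>K\<close>, then the first nonzero
  coefficient \<open>Q\<^sub>k(n)\<close> below that order satisfies \<open>Q\<^sub>k(n+p) = Q\<^sub>k(n)\<close>, because \<open>\<Phi>\<close> acts on leading terms by
  \<open>b\<^sup>p\<close>; being a periodic polynomial it is the constant \<open>Q\<^sub>k(0)\<close>, which is \<open>0\<close> by the condition on \<open>W\<^sub>0\<close>.
\<close>

lemma intertwined_family_vanishes:
  assumes W: "poly_family b W" "\<And>n. ord_ge (n + d) (W n)"
    and shift: "\<And>n. ord_ge (n + d + int p + int K) (W (n + int p) - Phi (W n))"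
    and zero: "ord_ge (d + int K) (W 0)"
  shows "ord_ge (n + d + int K) (W n)"
proof -
  have "k \<le> K \<Longrightarrow> ord_ge (n + d + int k) (W n)" for k n
  proof (induction k arbitrary: n)
    case (Suc k)
    then have IH: "\<And>n. ord_ge (n + d + int k) (W n)" and k: "k < K" by simp_all
    obtain Q where Q: "poly_seq Q" "\<And>n. W n $$ (n + (d + int k)) = b powi n * Q n"
      using poly_familyD[OF W(1), of "d + int k"] by blast
    have "Q (n + int p) = Q n" for n
    proof -
      have "W (n + int p) $$ (n + d + int k + int p) = Phi (W n) $$ (n + d + int k + int p)"
        using ord_geD[OF shift, of "n + d + int k + int p" n] k by simp
      also have "\<dots> = b ^ p * W n $$ (n + d + int k)" by (rule Phi_lead[OF IH])
      finally show ?thesis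
        using Q(2)[of "n + int p"] Q(2)[of n] b by (auto simp: b_powi_add algebra_simps)
    qed
    from periodic_poly_seq_const[OF Q(1) p this] have "Q n = Q 0" .
    moreover have "Q 0 = 0" using Q(2)[of 0] ord_geD[OF zero, of "d + int k"] k by simp
    ultimately have "W n $$ (n + d + int k) = 0" using Q(2)[of n] by (simp add: algebra_simps)
    show ?case unfolding ord_ge_def
    proof (intro allI impI)
      fix i assume "i < n + d + int (Suc k)"
      then consider "i < n + d + int k" | "i = n + d + int k" by force
      then show "W n $$ i = 0" using IH[of n] \<open>W n $$ _ = 0\<close> by cases (auto simp: ord_ge_def)
    qed
  qed (use W(2) in simp)
  then show ?thesis by simp
qed

text \<open>
  Comparing coefficients of \<open>t\<^bsup>n+p+k\<^esup>\<close> in \<open>T(s\<^bsup>n+p\<^esup>) = \<Phi>(T(s\<^sup>n))\<close> with \<open>T(s\<^sup>n) = b\<^sup>n \<Sum>\<^sub>j P\<^sub>j(n) t\<^bsup>n+j\<^esup>\<close> gives a difference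
  equation for \<open>P\<^sub>k\<close> whose right-hand side is a polynomial in \<open>n\<close> determined by the earlier \<open>P\<^sub>j\<close>.
\<close>

lemma intertwiner_coefficients_exist:
  "\<exists>P. \<forall>k. poly_seq (P k) \<and> P k 0 = (if k = 0 then 1 else 0) \<and>
     (\<forall>n. b ^ p * (P k (n + int p) - P k n) =
        (\<Sum>j<k. P j n * Phi (fls_X_intpow (n + int j)) $$ (n + int p + int k)))"
proof -
  define S where "S P k n = (\<Sum>j<k. P j n * Phi (fls_X_intpow (n + int j)) $$ (n + int p + int k))" for P k n
  \<comment> \<open>The requirement on \<open>P k = r\<close> is conditional, so that it can be met for every choice of the earlier terms.\<close>
  define C where "C P k r \<longleftrightarrow> ((\<forall>j<k. poly_seq (P j)) \<longrightarrow> 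
     poly_seq r \<and> r 0 = (if k = 0 then 1 else 0) \<and> (\<forall>n. b ^ p * (r (n + int p) - r n) = S P k n))"
    for P k r
  have "\<exists>P. \<forall>k. C P k (P k)"
  proof (rule dependent_wf_choice[OF wf_less_than])
    fix P P' :: "nat \<Rightarrow> int \<Rightarrow> 'k" and k r
    assume "\<And>j. (j, k) \<in> less_than \<Longrightarrow> P j = P' j"
    then show "C P k r = C P' k r" by (simp add: C_def S_def)
  next
    fix P :: "nat \<Rightarrow> int \<Rightarrow> 'k" and k
    show "\<exists>r. C P k r"
    proof (cases "\<forall>j<k. poly_seq (P j)")
      case True
      have coeff: "poly_seq (\<lambda>n. Phi (fls_X_intpow (n + int j)) $$ (n + int p + int k))" if "j < k" for j
        using poly_seq_shift[OF Phi_X_intpow_poly_seq[of "k - j"], of "int j"] that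
        by (simp add: of_nat_diff algebra_simps)
      have "poly_seq (\<lambda>n. (1 / b ^ p) * S P k n)"
        unfolding S_def by (intro poly_seq_mult poly_seq_const poly_seq_sum) (use True coeff in auto)
      from antidifference_exists[OF p this] obtain Q where Q: "poly_seq Q" "Q 0 = 0"
        "\<And>n. Q (n + int p) - Q n = (1 / b ^ p) * S P k n" by blast
      have "C P k (\<lambda>n. Q n + (if k = 0 then 1 else 0))"
        unfolding C_def using Q b by (auto intro: poly_seq_add poly_seq_const)
      then show ?thesis by blast
    qed (auto simp: C_def)
  qed
  then obtain P where P: "\<And>k. C P k (P k)" by blast
  have poly: "poly_seq (P k)" for k
    by (induction k rule: less_induct) (use P in \<open>auto simp: C_def\<close>)
  show ?thesis
    using P poly by (intro exI[of _ P]) (auto simp: C_def S_def)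
qed

lemma sum_atLeastAtMost_int: "(\<Sum>i\<in>{n..n + int k}. f i) = (\<Sum>j\<le>k. f (n + int j))"
  by (rule sum.reindex_bij_witness[of _ "\<lambda>j. n + int j" "\<lambda>i. nat (i - n)"]) auto

text \<open>
  Argument and value are series in different variables, \<open>s = z\<^bsup>1/p\<^esup>\<close> and \<open>t = \<theta>\<^bsup>1/q\<^esup>\<close>; the last condition turns
  multiplication by \<open>z = s\<^sup>p\<close> into \<open>\<Phi>\<close>.  The others make the uniqueness principle applicable.
\<close>

definition intertwiner :: "('k fls \<Rightarrow> 'k fls) \<Rightarrow> bool" where
  "intertwiner T \<longleftrightarrow> filtered_map T 0 \<and> poly_family b (\<lambda>n. T (fls_X_intpow n)) \<and>
     (\<forall>n. T (fls_X_intpow n) $$ n = b powi n) \<and> T 1 = 1 \<and> (\<forall>h. T (fls_X_intpow (int p) * h) = Phi (T h))"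

lemma intertwiner_exists: "\<exists>T. intertwiner T"
proof -
  obtain P where "\<forall>k. poly_seq (P k) \<and> P k 0 = (if k = 0 then 1 else 0) \<and>
     (\<forall>n. b ^ p * (P k (n + int p) - P k n) =
        (\<Sum>j<k. P j n * Phi (fls_X_intpow (n + int j)) $$ (n + int p + int k)))"
    using intertwiner_coefficients_exist by (rule exE)
  then have P: "\<And>k. poly_seq (P k)" "\<And>k. P k 0 = (if k = 0 then 1 else 0)"
    "\<And>k n. b ^ p * (P k (n + int p) - P k n) =
        (\<Sum>j<k. P j n * Phi (fls_X_intpow (n + int j)) $$ (n + int p + int k))"
    by blast+
  obtain T where T: "filtered_map T 0"
    and T_nth: "\<And>n i. T (fls_X_intpow n) $$ i = (if i < n then 0 else b powi n * P (nat (i - n)) n)"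
    using filtered_map_exists[of "\<lambda>n j. b powi n * P j n"] by auto
  interpret T: filtered_map T 0 by fact
  have "poly_family b (\<lambda>n. T (fls_X_intpow n))"
    unfolding poly_family_def
  proof
    fix j
    show "\<exists>Q. poly_seq Q \<and> (\<forall>n. T (fls_X_intpow n) $$ (n + j) = b powi n * Q n)"
    proof (cases "j < 0")
      case True
      then show ?thesis by (intro exI[of _ "\<lambda>_. 0"]) (auto simp: T_nth)
    next
      case False
      then show ?thesis using P(1) by (intro exI[of _ "P (nat j)"]) (auto simp: T_nth)
    qed
  qed
  moreover have "P 0 n = 1" for n
    using periodic_poly_seq_const[OF P(1) p, of 0 n] P(2)[of 0] P(3)[of 0] b by simp
  then have "T (fls_X_intpow n) $$ n = b powi n" for n by (simp add: T_nth)
  moreover have "T 1 = 1"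
  proof -
    have "T (fls_X_intpow 0) = 1" by (rule fls_eqI) (simp only: T_nth, simp add: P(2))
    then show ?thesis by simp
  qed
  moreover have "T (fls_X_intpow (int p) * h) = Phi (T h)" for h
  proof -
    have mono: "T (fls_X_intpow (n + int p)) = Phi (T (fls_X_intpow n))" for n
    proof (rule fls_eqI)
      fix m
      have n: "ord_ge n (T (fls_X_intpow n))" using T.ord[OF ord_ge_fls_X_intpow, of n] by simp
      show "T (fls_X_intpow (n + int p)) $$ m = Phi (T (fls_X_intpow n)) $$ m"
      proof (cases "m < n + int p")
        case True
        then show ?thesis using Phi.ord[OF n] by (simp only: T_nth ord_ge_def) simp
      next
        case False
        then obtain k where m: "m = n + int p + int k" by (meson linorder_not_le zle_iff_zadd)
        have mp: "m - int p = n + int k" using m by simp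
        have "Phi (T (fls_X_intpow n)) $$ m =
            (\<Sum>j\<le>k. T (fls_X_intpow n) $$ (n + int j) * Phi (fls_X_intpow (n + int j)) $$ m)"
          unfolding Phi.expand[OF n, of m] mp by (rule sum_atLeastAtMost_int)
        also have "\<dots> = b powi n * ((\<Sum>j<k. P j n * Phi (fls_X_intpow (n + int j)) $$ m)
             + P k n * Phi (fls_X_intpow (n + int k)) $$ (n + int k + int p))"
          by (simp only: T_nth) (simp add: m lessThan_Suc_atMost[symmetric] sum_distrib_left algebra_simps)
        also have "\<dots> = b powi n * (b ^ p * (P k (n + int p) - P k n) + P k n * b ^ p)"
          unfolding Phi_lead[OF ord_ge_fls_X_intpow] by (simp add: P(3) m)
        also have "\<dots> = b powi (n + int p) * P k (n + int p)"
          by (simp add: b_powi_add algebra_simps)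
        also have "\<dots> = T (fls_X_intpow (n + int p)) $$ m" by (simp only: T_nth) (simp add: m)
        finally show ?thesis ..
      qed
    qed
    have "filtered_map (\<lambda>h. T (fls_X_intpow (int p) * h)) (int p)"
      using filtered_map_compose[OF T filtered_map_mult[OF ord_ge_fls_X_intpow[of "int p"]]] by simp
    moreover have "filtered_map (\<lambda>h. Phi (T h)) (int p)"
      using filtered_map_compose[OF Phi.filtered_map_axioms T] by simp
    ultimately show ?thesis
      by (rule filtered_map_eqI) (simp only: fls_X_intpow_times_fls_X_intpow mono[symmetric] add.commute)
  qed
  ultimately show ?thesis unfolding intertwiner_def using T by blast
qed

end

section \<open>The connection and its exponent\<close>

lemma ord_ge_Suc: "ord_ge N v \<Longrightarrow> v $$ N = 0 \<Longrightarrow> ord_ge (N + 1) v"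
  unfolding ord_ge_def by (metis zle_add1_eq_le order_le_less)

lemma ord_ge_uminus: "ord_ge N v \<Longrightarrow> ord_ge N (- v)" for v :: "'k::group_add fls"
  by (simp add: ord_ge_def)

lemma ord_ge_const_mult: "ord_ge N v \<Longrightarrow> ord_ge N (fls_const c * v)" for v :: "'k::comm_ring_1 fls"
  by (simp add: ord_ge_def)

lemma euler_nth: "(fls_X * fls_deriv v) $$ n = of_int n * v $$ n" for v :: "'k::comm_ring_1 fls"
  by (simp add: fls_X_times_conv_shift)

lemma euler_X_intpow: "fls_X * fls_deriv (fls_X_intpow n) = fls_const (of_int n) * (fls_X_intpow n :: 'k::comm_ring_1 fls)"
  by (rule fls_eqI) (simp only: euler_nth, simp)

lemma euler_filtered_map: "filtered_map (\<lambda>v :: 'k::field fls. fls_X * fls_deriv v) 0"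
proof
  show "ord_ge (N + 0) (fls_X * fls_deriv v)" if "ord_ge N v" for N and v :: "'k fls"
    using that unfolding ord_ge_def euler_nth by simp
qed (simp_all add: algebra_simps)

text \<open>
  The equation \<open>s u' = d u\<close> has the solution \<open>u = exp(\<integral> d/s)\<close>, a power series because \<open>d/s\<close> is one.
\<close>

lemma gauge_exists:
  fixes d :: "'k::field_char_0 fls"
  assumes "ord_ge 1 d"
  obtains u :: "'k fps" where "u $ 0 = 1" "fls_X * fls_deriv (fps_to_fls u) = d * fps_to_fls u"
proof -
  obtain r where r: "d = fls_X_intpow 1 * fps_to_fls r" using assms by (rule ord_ge_obtain_fps)
  define R where "R = fps_integral0 r"
  have R: "R $ 0 = 0" "fps_deriv R = r" by (simp_all add: R_def fps_deriv_fps_integral)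
  define u where "u = fps_exp 1 oo R"
  have "fps_deriv u = r * u" by (simp add: u_def fps_compose_deriv R mult.commute)
  then have "fls_X * fls_deriv (fps_to_fls u) = d * fps_to_fls u"
    by (simp add: fls_deriv_fps_to_fls fls_times_fps_to_fls r fls_X_conv_shift_1 mult.assoc)
  moreover have "u $ 0 = 1" by (simp add: u_def)
  ultimately show thesis by (rule that[rotated])
qed

context difference_operator
begin

lemma intertwinerD:
  assumes "intertwiner T"
  shows "filtered_map T 0" "poly_family b (\<lambda>n. T (fls_X_intpow n))"
    "T (fls_X_intpow n) $$ n = b powi n" "T 1 = 1" "T (fls_X_intpow (int p) * h) = Phi (T h)"
    "T (fls_X_intpow (n + int p)) = Phi (T (fls_X_intpow n))"
    "bij T" "ord_ge N (T h) \<longleftrightarrow> ord_ge N h"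
proof -
  show *: "filtered_map T 0" "poly_family b (\<lambda>n. T (fls_X_intpow n))"
    "T (fls_X_intpow n) $$ n = b powi n" "T 1 = 1" "T (fls_X_intpow (int p) * h) = Phi (T h)" for n h
    using assms by (simp_all add: intertwiner_def)
  show "T (fls_X_intpow (n + int p)) = Phi (T (fls_X_intpow n))"
    using *(5)[of "fls_X_intpow n"] by (simp only: fls_X_intpow_times_fls_X_intpow add.commute)
  have "T (fls_X_intpow n) $$ n \<noteq> 0" for n using *(3)[of n] b by simp
  from filtered_map_bijective[OF *(1) this] show "bij T" "ord_ge N (T h) \<longleftrightarrow> ord_ge N h" by auto
qed

text \<open>
  Let \<open>f\<close> be defined by \<open>T f = - \<theta>\<^sup>-\<^sup>1\<close>.  Then \<open>T \<circ> (z d/dz + f) = - \<theta>\<^sup>-\<^sup>1 T\<close>: the defect \<open>W\<^sub>n\<close> of this equation at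
  \<open>s\<^sup>n\<close> is a polynomial family; multiplying \<open>s\<^sup>n\<close> by \<open>z\<close> adds \<open>1\<close> to \<open>z d/dz\<close> just as \<open>\<Phi>\<close> adds \<open>1\<close> to \<open>\<theta>\<^sup>-\<^sup>1\<close>, so
  \<open>W\<^bsub>n+p\<^esub> = \<Phi> W\<^sub>n\<close>; and \<open>W\<^sub>0 = 0\<close> by the choice of \<open>f\<close>.
\<close>

lemma intertwiner_connection:
  assumes T: "intertwiner T"
  obtains f where "T f = - fls_X_intpow (- int q)"
    "\<And>h. T (fls_const (1 / of_nat p) * (fls_X * fls_deriv h) + f * h) = - (fls_X_intpow (- int q) * T h)"
proof -
  note T' = intertwinerD[OF T]
  interpret T: filtered_map T 0 by (rule T')
  obtain f where f: "T f = - fls_X_intpow (- int q)" using \<open>bij T\<close> by (metis bij_pointE)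
  have f_ord: "ord_ge (- int q) f"
    using T'(8)[of "- int q" f, unfolded f] ord_ge_uminus[OF ord_ge_fls_X_intpow] by blast
  define c :: "int \<Rightarrow> 'k" where "c n = of_int n / of_nat p" for n
  define W where "W n = fls_const (c n) * T (fls_X_intpow n) + T (f * fls_X_intpow n)
    + fls_X_intpow (- int q) * T (fls_X_intpow n)" for n
  have "poly_seq c" unfolding c_def divide_inverse by (intro poly_seq_mult poly_seq_of_int poly_seq_const)
  then have fam: "poly_family b W" unfolding W_def
    by (intro poly_family_add poly_family_scale poly_family_image_mult poly_family_X_intpow_mult T' b)
  have W_ord: "ord_ge (n + (- int q)) (W n)" for n
  proof -
    have Tn: "ord_ge n (T (fls_X_intpow n))" by (simp add: T'(8) ord_ge_fls_X_intpow)
    have "ord_ge (- int q + n) (T (f * fls_X_intpow n))"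
      unfolding T'(8) by (intro ord_ge_mult f_ord ord_ge_fls_X_intpow)
    moreover have "ord_ge (- int q + n) (fls_X_intpow (- int q) * T (fls_X_intpow n))"
      by (intro ord_ge_mult ord_ge_fls_X_intpow Tn)
    moreover have "ord_ge (- int q + n) (fls_const (c n) * T (fls_X_intpow n))"
      by (intro ord_ge_const_mult ord_ge_mono[OF Tn]) simp
    ultimately show ?thesis unfolding W_def by (simp add: add.commute ord_ge_add)
  qed
  have shift: "W (n + int p) = Phi (W n)" for n
  proof -
    have "f * fls_X_intpow (n + int p) = fls_X_intpow (int p) * (f * fls_X_intpow n)"
      by (simp only: fls_X_intpow_times_fls_X_intpow[symmetric] mult_ac)
    then have 1: "T (f * fls_X_intpow (n + int p)) = Phi (T (f * fls_X_intpow n))" by (simp only: T')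
    have "c (n + int p) = c n + 1" using p by (simp add: c_def field_simps)
    then have 2: "fls_const (c (n + int p)) = fls_const (c n) + 1" by (simp flip: fls_plus_const)
    show ?thesis
      unfolding W_def 1 2 T'(6) Phi.add Phi.const_mult Phi_theta_inverse by (simp add: algebra_simps)
  qed
  have "W 0 = 0" by (simp add: W_def c_def f T'(4))
  have vanish: "ord_ge (n + (- int q) + int K) (W n)" for n K
    by (rule intertwined_family_vanishes[OF fam W_ord]) (simp_all add: shift \<open>W 0 = 0\<close> ord_ge_def)
  have W0: "W n = 0" for n
  proof (rule fls_eqI)
    fix i
    show "W n $$ i = 0 $$ i"
      using ord_geD[OF vanish[of n "nat (i - n + int q + 1)"], of i] by simp
  qed
  have "filtered_map (\<lambda>h :: 'k fls. fls_const (1 / of_nat p) * (fls_X * fls_deriv h)) (- int q)"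
  proof
    show "ord_ge (N + - int q) (fls_const (1 / of_nat p) * (fls_X * fls_deriv v))" if "ord_ge N v" for N and v :: "'k fls"
      using filtered_map.ord[OF euler_filtered_map that] by (intro ord_ge_const_mult) (auto intro: ord_ge_mono)
  qed (simp_all add: algebra_simps)
  from filtered_map_compose[OF T'(1) filtered_map_add[OF this filtered_map_mult[OF f_ord]]]
  have L: "filtered_map (\<lambda>h. T (fls_const (1 / of_nat p) * (fls_X * fls_deriv h) + f * h)) (- int q)" by simp
  from filtered_map_compose[OF filtered_map_mult[OF ord_ge_uminus[OF ord_ge_fls_X_intpow[of "- int q"]]] T'(1)]
  have R: "filtered_map (\<lambda>h. - fls_X_intpow (- int q) * T h) (- int q)" by simp
  have mono: "T (fls_const (1 / of_nat p) * (fls_X * fls_deriv (fls_X_intpow n)) + f * fls_X_intpow n)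
      = - fls_X_intpow (- int q) * T (fls_X_intpow n)" for n
  proof -
    have "fls_const (1 / of_nat p) * (fls_X * fls_deriv (fls_X_intpow n)) = fls_const (c n) * (fls_X_intpow n :: 'k fls)"
      unfolding euler_X_intpow by (simp only: mult.assoc[symmetric] fls_const_mult_const c_def) simp
    then show ?thesis
      using W0[of n] unfolding W_def by (simp only: T.add T.const_mult) (simp add: eq_neg_iff_add_eq_0)
  qed
  have "T (fls_const (1 / of_nat p) * (fls_X * fls_deriv h) + f * h) = - fls_X_intpow (- int q) * T h" for h
    by (rule filtered_map_eqI[OF L R mono])
  then show thesis using that f by simp
qed

text \<open>
  For \<open>\<sigma>\<^sup>p = g + a (p+q)/(2q) \<theta>\<^bsup>1+p/q\<^esup>\<close>, where \<open>a = b\<^sup>p\<close>, the ansatz \<open>T(s\<^sup>n) \<approx> \<sigma>\<^sup>n + b\<^sup>n Q(n) t\<^bsup>n+q\<^esup>\<close> satisfies the recursion to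
  relative order \<open>q\<close> exactly if \<open>Q(n+p) - Q(n) = - (p+q)/(2q) - n/q\<close>: the first summand comes from the term
  added to \<open>g\<close>, the second from the first-order part of \<open>\<phi>\<close>.  With \<open>Q(0) = 0\<close> the solution is
  \<open>Q(n) = - n (n+q)/(2pq)\<close>, and the uniqueness principle makes the ansatz correct.
\<close>

lemma intertwiner_second_order:
  fixes \<sigma> :: "'k fps"
  assumes T: "intertwiner T"
    and \<sigma>: "\<sigma> $ 0 = 0" "\<sigma> $ 1 = b"
    and \<sigma>_power: "fps_to_fls \<sigma> ^ p = g + fls_const (b ^ p * (of_nat (p + q) / of_nat (2 * q))) * fls_X_intpow (int (p + q))"
  shows "ord_ge (n + int q + 1) (T (fls_X_intpow n) - (fps_to_fls \<sigma> powi n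
    + fls_const (b powi n * (- (of_int n * of_int (n + int q)) / of_nat (2 * p * q))) * fls_X_intpow (n + int q)))"
proof -
  note T' = intertwinerD[OF T]
  interpret T: filtered_map T 0 by (rule T')
  have \<sigma>1: "\<sigma> $ 1 \<noteq> 0" using \<sigma>(2) b by simp
  define c :: 'k where "c = of_nat (p + q) / of_nat (2 * q)"
  define Q :: "int \<Rightarrow> 'k" where "Q n = - (of_int n * of_int (n + int q)) / of_nat (2 * p * q)" for n
  define S where "S n = fps_to_fls \<sigma> powi n" for n
  define k where "k n = fls_const (b powi n * Q n) * fls_X_intpow (n + int q)" for n
  define W where "W n = T (fls_X_intpow n) - (S n + k n)" for n
  have S_ord: "ord_ge n (S n)" and S_lead: "S n $$ n = b powi n" for n
    using ord_ge_linear_fps_powi[OF \<sigma>(1) \<sigma>1, of n] \<sigma>(2) by (simp_all add: S_def)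
  have S_shift: "S (n + int p) = S n * (g + fls_const (b ^ p * c) * fls_X_intpow (int (p + q)))" for n
  proof -
    have nz: "fps_to_fls \<sigma> \<noteq> 0" using \<sigma>1 by auto
    show ?thesis by (simp only: S_def c_def power_int_add[OF disjI1[OF nz]] power_int_of_nat \<sigma>_power)
  qed
  have Q_shift: "Q n - Q (n + int p) = c + of_int n / of_nat q" for n
    using p q by (simp add: Q_def c_def field_simps)
  have "Q = (\<lambda>n. (- 1 / of_nat (2 * p * q)) * (of_int n * of_int (n + int q)))" by (intro ext) (simp add: Q_def)
  moreover have "poly_seq (\<lambda>n. (- 1 / of_nat (2 * p * q)) * (of_int n * of_int (n + int q)) :: 'k)"
    by (intro poly_seq_mult poly_seq_const poly_seq_of_int poly_seq_shift[OF poly_seq_of_int])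
  ultimately have "poly_seq Q" by simp
  then have fam: "poly_family b W"
    unfolding W_def S_def k_def
    using poly_family_linear_fps_powi[OF \<sigma>(1) \<sigma>1] \<sigma>(2)
    by (intro poly_family_diff poly_family_add poly_family_X_intpow T') simp_all
  have k_ord: "ord_ge (n + int q) (k n)" for n unfolding k_def by (intro ord_ge_const_mult ord_ge_fls_X_intpow)
  have W_ord: "ord_ge (n + 0) (W n)" for n
    unfolding W_def
    by (intro ord_ge_diff ord_ge_add) (simp_all add: T'(8) ord_ge_fls_X_intpow S_ord ord_ge_mono[OF k_ord])
  have shift: "ord_ge (n + int p + int q + 1) (W (n + int p) - Phi (W n))" for n
  proof -
    define x where "x = of_int n / of_nat q * b powi n"
    define E where "E = phi q (S n) - S n + fls_const x * fls_X_intpow (n + int q)"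
    have E: "ord_ge (n + int q + 1) E"
      using phi_first_order[OF q S_ord, of n] unfolding E_def x_def S_lead .
    have "Phi (S n) = g * (S n - fls_const x * fls_X_intpow (n + int q) + E)"
      by (simp add: Phi_def E_def)
    then have eq: "W (n + int p) - Phi (W n) = - (fls_const (b ^ p * c) * (fls_X_intpow (int (p + q)) * S n))
        - fls_const x * (g * fls_X_intpow (n + int q)) + g * E + Phi (k n) - k (n + int p)"
      unfolding W_def T'(6) S_shift Phi.diff Phi.add by (simp add: algebra_simps)
    \<comment> \<open>It remains to add up the coefficients of degree \<open>M\<close>; nothing occurs in lower degrees.\<close>
    define M where "M = n + int p + int q"
    have o1: "ord_ge M (fls_X_intpow (int (p + q)) * S n)"
      using ord_ge_mult[OF ord_ge_fls_X_intpow S_ord, of "int (p + q)" n] by (simp add: M_def algebra_simps)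
    have o2: "ord_ge M (g * fls_X_intpow (n + int q))"
      using ord_ge_mult[OF g_ord ord_ge_fls_X_intpow, of "n + int q"] by (simp add: M_def algebra_simps)
    have o3: "ord_ge (M + 1) (g * E)"
      using ord_ge_mult[OF g_ord E] by (simp add: M_def algebra_simps)
    have o4: "ord_ge M (Phi (k n))" using Phi.ord[OF k_ord, of n] by (simp add: M_def algebra_simps)
    have o5: "ord_ge M (k (n + int p))" using k_ord[of "n + int p"] by (simp add: M_def algebra_simps)
    have c1: "(fls_X_intpow (int (p + q)) * S n) $$ M = b powi n"
      by (simp only: fls_X_intpow_times_conv_shift) (simp add: M_def S_lead)
    have c2: "(g * fls_X_intpow (n + int q)) $$ M = b ^ p"
      by (simp only: fls_X_intpow_times_comm[symmetric] fls_X_intpow_times_conv_shift) (simp add: M_def g_lead)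
    have c3: "(g * E) $$ M = 0" using o3 by (simp add: ord_ge_def)
    have c4: "Phi (k n) $$ M = b ^ p * (b powi n * Q n)"
      using Phi_lead[OF k_ord, of n] by (simp add: M_def k_def algebra_simps)
    have c5: "k (n + int p) $$ M = b powi n * b ^ p * Q (n + int p)"
      by (simp add: k_def M_def b_powi_add)
    have "(W (n + int p) - Phi (W n)) $$ M = b ^ p * b powi n * (Q n - Q (n + int p) - (c + of_int n / of_nat q))"
      unfolding eq fls_plus_nth fls_minus_nth fls_uminus_nth fls_mult_const_nth c1 c2 c3 c4 c5
      by (simp add: x_def algebra_simps)
    also have "\<dots> = 0" by (simp add: Q_shift)
    finally have "(W (n + int p) - Phi (W n)) $$ M = 0" .
    moreover have "ord_ge M (W (n + int p) - Phi (W n))"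
      unfolding eq using o1 o2 o3 o4 o5
      by (intro ord_ge_diff ord_ge_add ord_ge_uminus ord_ge_const_mult) (auto intro: ord_ge_mono)
    ultimately have "ord_ge (M + 1) (W (n + int p) - Phi (W n))" by (intro ord_ge_Suc)
    then show ?thesis by (simp only: M_def)
  qed
  have "W 0 = 0" by (simp add: W_def T'(4) S_def k_def Q_def)
  have "ord_ge (n + 0 + int (q + 1)) (W n)"
    by (rule intertwined_family_vanishes[OF fam W_ord])
       (use shift in \<open>simp_all add: \<open>W 0 = 0\<close> ord_ge_def add_ac\<close>)
  then show ?thesis by (simp add: W_def S_def k_def Q_def add_ac)
qed

text \<open>
  The correction \<open>Q(n)\<close> vanishes at \<open>n = -q\<close>, the leading exponent of \<open>f\<close>, and all other terms of \<open>f\<close> feel it only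
  in positive degree.  Hence \<open>T f\<close> and \<open>f \<circ> \<sigma> = - \<theta>\<^sup>-\<^sup>1 = T f'\<close> agree modulo \<open>t \<Bbbk>[[t]]\<close>.  This is the reason for the
  constant \<open>(p+q)/(2q)\<close> in the system.
\<close>

lemma intertwiner_exponent:
  fixes \<sigma> :: "'k fps"
  assumes T: "intertwiner T" and f': "T f' = - fls_X_intpow (- int q)"
    and \<sigma>: "\<sigma> $ 0 = 0" "\<sigma> $ 1 = b"
    and \<sigma>_power: "fps_to_fls \<sigma> ^ p = g + fls_const (b ^ p * (of_nat (p + q) / of_nat (2 * q))) * fls_X_intpow (int (p + q))"
    and f: "ord_ge (- int q) f" "fls_compose_fps f \<sigma> = - fls_X_intpow (- int q)"
  shows "ord_ge 1 (f' - f)"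
proof -
  note T' = intertwinerD[OF T]
  have \<sigma>1: "\<sigma> $ 1 \<noteq> 0" using \<sigma>(2) b by simp
  interpret T: filtered_map T 0 by (rule T')
  interpret D: filtered_map "\<lambda>v. fls_compose_fps v \<sigma> - T v" 0
    by (intro filtered_map_diff filtered_map_compose_fps \<sigma> \<sigma>1 T')
  have "(fls_compose_fps f \<sigma> - T f) $$ m = 0" if "m < 1" for m
    unfolding D.expand[OF f(1)]
  proof (intro sum.neutral ballI)
    fix n assume n: "n \<in> {- int q..m - 0}"
    define k where "k = b powi n * (- (of_int n * of_int (n + int q)) / of_nat (2 * p * q))"
    have "(T (fls_X_intpow n) - (fps_to_fls \<sigma> powi n + fls_const k * fls_X_intpow (n + int q))) $$ m = 0"
      using intertwiner_second_order[OF T \<sigma> \<sigma>_power, of n] unfolding k_def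
      by (rule ord_geD) (use n that in simp)
    moreover have "(fls_const k * fls_X_intpow (n + int q)) $$ m = 0"
    proof (cases "n = - int q")
      case True
      then have "k = 0" by (simp add: k_def)
      then show ?thesis by simp
    qed (use n that in auto)
    ultimately have "(fls_compose_fps (fls_X_intpow n) \<sigma> - T (fls_X_intpow n)) $$ m = 0"
      unfolding filtered_map_compose_fps(2)[OF \<sigma>(1) \<sigma>1] by simp
    then show "f $$ n * (fls_compose_fps (fls_X_intpow n) \<sigma> - T (fls_X_intpow n)) $$ m = 0" by simp
  qed
  then have "ord_ge 1 (T (f' - f))" by (simp add: T.diff f' f(2) ord_ge_def)
  then show ?thesis by (simp add: T'(8))
qed

text \<open>
  Precomposing an intertwiner with multiplication by a unit \<open>u\<close> changes the exponent from \<open>f'\<close> to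
  \<open>f' + z u\<^sup>-\<^sup>1 du/dz\<close>, and every change by an element of \<open>s \<Bbbk>[[s]]\<close> arises in this way.
\<close>

lemma intertwiner_solution:
  fixes \<sigma> :: "'k fps"
  assumes \<sigma>: "\<sigma> $ 0 = 0" "\<sigma> $ 1 = b"
    and \<sigma>_power: "fps_to_fls \<sigma> ^ p = g + fls_const (b ^ p * (of_nat (p + q) / of_nat (2 * q))) * fls_X_intpow (int (p + q))"
    and f: "ord_ge (- int q) f" "fls_compose_fps f \<sigma> = - fls_X_intpow (- int q)"
  shows "\<exists>T. filtered_map T 0 \<and> bij T \<and> (\<forall>N h. ord_ge N (T h) \<longleftrightarrow> ord_ge N h) \<and>
    (\<forall>h. T (fls_X_intpow (int p) * h) = Phi (T h)) \<and>
    (\<forall>h. T (fls_const (1 / of_nat p) * (fls_X * fls_deriv h) + f * h) = - (fls_X_intpow (- int q) * T h))"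
proof -
  obtain T0 where T0: "intertwiner T0" using intertwiner_exists by blast
  note T0' = intertwinerD[OF T0]
  interpret T0: filtered_map T0 0 by (rule T0')
  obtain f' where f': "T0 f' = - fls_X_intpow (- int q)"
    "\<And>h. T0 (fls_const (1 / of_nat p) * (fls_X * fls_deriv h) + f' * h) = - (fls_X_intpow (- int q) * T0 h)"
    using intertwiner_connection[OF T0] by blast
  have "ord_ge 1 (fls_const (of_nat p) * (f - f'))"
    using ord_ge_const_mult[OF ord_ge_uminus[OF intertwiner_exponent[OF T0 f'(1) \<sigma> \<sigma>_power f]]] by simp
  then obtain u where u: "u $ 0 = 1"
    "fls_X * fls_deriv (fps_to_fls u) = fls_const (of_nat p) * (f - f') * fps_to_fls u"
    by (rule gauge_exists)
  define U where "U = fps_to_fls u"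
  have "fls_const (1 / of_nat p) * (fls_X * fls_deriv U)
      = (fls_const (1 / of_nat p) * fls_const (of_nat p)) * (f - f') * U"
    using u(2) unfolding U_def by (simp only: mult.assoc)
  then have U: "fls_const (1 / of_nat p) * (fls_X * fls_deriv U) = (f - f') * U"
    using p by simp
  have U_ord: "ord_ge 0 U" by (simp add: U_def ord_ge_fps)
  define T where "T h = T0 (U * h)" for h
  have T: "filtered_map T 0"
    using filtered_map_compose[OF T0'(1) filtered_map_mult[OF U_ord]] unfolding T_def by simp
  have lead: "T (fls_X_intpow n) $$ n \<noteq> 0" for n
  proof -
    have ord: "ord_ge n (U * fls_X_intpow n)" using ord_ge_mult[OF U_ord ord_ge_fls_X_intpow, of n] by simp
    have "(U * fls_X_intpow n) $$ n = 1"
      by (simp add: U_def u(1) fls_X_intpow_times_comm[symmetric] fls_X_intpow_times_conv_shift)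
    then have "T (fls_X_intpow n) $$ n = b powi n" unfolding T_def T0.expand[OF ord] by (simp add: T0'(3))
    then show ?thesis using b by simp
  qed
  have "T (fls_X_intpow (int p) * h) = Phi (T h)" for h
    unfolding T_def by (simp only: T0'(5)[symmetric] mult_ac)
  moreover have "T (fls_const (1 / of_nat p) * (fls_X * fls_deriv h) + f * h) = - (fls_X_intpow (- int q) * T h)" for h
  proof -
    have "U * (fls_const (1 / of_nat p) * (fls_X * fls_deriv h) + f * h)
        = fls_const (1 / of_nat p) * (fls_X * (fls_deriv U * h + U * fls_deriv h))
          - fls_const (1 / of_nat p) * (fls_X * fls_deriv U) * h + f * U * h"
      by (simp add: algebra_simps)
    also have "\<dots> = fls_const (1 / of_nat p) * (fls_X * fls_deriv (U * h)) + f' * (U * h)"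
      unfolding U by (simp add: algebra_simps)
    finally show ?thesis unfolding T_def by (simp only: f'(2))
  qed
  ultimately show ?thesis using T filtered_map_bijective[OF T lead] by (intro exI[of _ T]) simp
qed

end

section \<open>Transport of structure\<close>

lemma transport_module:
  fixes s :: "'k::field \<Rightarrow> 'v::ab_group_add \<Rightarrow> 'v" and T :: "'v \<Rightarrow> 'w::ab_group_add"
  assumes s: "vector_space s" and bij: "bij T" and add: "\<And>v w. T (v + w) = T v + T w"
  defines "s' \<equiv> \<lambda>h v. T (s h (inv T v))"
  shows "vector_space s'" and "Vector_Spaces.linear s s' T" and "Vector_Spaces.linear s' s (inv T)"
proof -
  interpret vector_space s by fact
  have inv: "inv T (T v) = v" "T (inv T w) = w" for v w
    using bij by (simp_all add: bij_is_inj bij_is_surj surj_f_inv_f)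
  have inv_add: "inv T (v + w) = inv T v + inv T w" for v w
    by (metis add inv)
  show s': "vector_space s'"
    unfolding s'_def
    by unfold_locales (simp_all add: inv inv_add scale_right_distrib scale_left_distrib add)
  show "Vector_Spaces.linear s s' T" "Vector_Spaces.linear s' s (inv T)"
    unfolding Vector_Spaces.linear_iff using s s' by (simp_all add: s'_def add inv inv_add)
qed

lemma finite_spanning_transport:
  fixes s :: "'k::field fls \<Rightarrow> 'v::ab_group_add \<Rightarrow> 'v" and T :: "'v \<Rightarrow> 'w::ab_group_add"
  assumes "vector_space s" and "bij T" and "\<And>v w. T (v + w) = T v + T w" and B: "finite_spanning s B"
  shows "finite_spanning (\<lambda>h v. T (s h (inv T v))) (T ` B)"
proof -
  interpret Vector_Spaces.linear s "\<lambda>h v. T (s h (inv T v))" T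
    using assms(1-3) by (rule transport_module(2))
  show ?thesis using B \<open>bij T\<close> by (simp add: finite_spanning_def span_image bij_is_surj)
qed

lemma connection_transport:
  fixes s :: "'k::field_char_0 fls \<Rightarrow> 'v::ab_group_add \<Rightarrow> 'v" and T :: "'v \<Rightarrow> 'w::ab_group_add"
  assumes "connection s n" and bij: "bij T" and add: "\<And>v w. T (v + w) = T v + T w"
  shows "connection_iso (\<lambda>h v. T (s h (inv T v)), \<lambda>v. T (n (inv T v))) (s, n)"
proof -
  interpret connection s n by fact
  have s: "vector_space s" by unfold_locales
  have inv: "inv T (T v) = v" "T (inv T w) = w" for v w
    using bij by (simp_all add: bij_is_inj bij_is_surj surj_f_inv_f)
  have inv_add: "inv T (v + w) = inv T v + inv T w" for v w
    by (metis add inv)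
  obtain B where B: "finite_spanning s B" using finite_dim by blast
  have "connection (\<lambda>h v. T (s h (inv T v))) (\<lambda>v. T (n (inv T v)))"
  proof (intro connection.intro connection_axioms.intro transport_module(1) s bij add)
    show "\<exists>B. finite_spanning (\<lambda>h v. T (s h (inv T v))) B"
      using finite_spanning_transport[OF s bij add B] by blast
  qed (simp_all add: inv inv_add nabla_add nabla_const leibniz add)
  then show ?thesis
    unfolding connection_iso_def fst_conv snd_conv
    using transport_module(3)[OF s bij add] bij_imp_bij_inv[OF bij] \<open>connection s n\<close>
    by (auto simp: inv intro!: exI[of _ "inv T"])
qed

section \<open>The adic topology\<close>

text \<open>
  Over \<open>\<Bbbk>[[x]]\<close>, the monomials \<open>1, y, \<dots>, y\<^bsup>m-1\<^esup>\<close> with \<open>y = x\<^bsup>1/m\<^esup>\<close> generate all of \<open>\<Bbbk>[[y]]\<close>: sort the exponents by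
  their residue modulo \<open>m\<close>.
\<close>

lemma monomial_decomposition:
  fixes h :: "'k::field fls"
  assumes m: "m > 0" and h: "ord_ge (int (m * N)) h"
  shows "h = (\<Sum>i<m. fls_compose_power (fls_X ^ N * fps_to_fls (Abs_fps (\<lambda>n. h $$ (int (m * (N + n) + i))))) m * fls_X ^ i)"
    (is "h = (\<Sum>i<m. fls_compose_power (?G i) m * fls_X ^ i)")
proof (rule fls_eqI)
  fix n
  have G: "?G i $$ k = h $$ (int m * k + int i)" if "i < m" for i k
  proof (cases "k < int N")
    case True
    then have "int m * (k + 1) \<le> int m * int N" by (intro mult_left_mono) simp_all
    moreover have "int m * k + int i < int m * (k + 1)" using that by (simp add: distrib_left)
    ultimately have "int m * k + int i < int (m * N)" by simp
    then have "h $$ (int m * k + int i) = 0" using h by (simp add: ord_ge_def)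
    then show ?thesis using True by (simp add: fls_X_power_times_conv_shift)
  next
    case False
    then obtain j where "k = int N + int j" by (meson linorder_not_le zle_iff_zadd)
    then show ?thesis by (simp add: fls_X_power_times_conv_shift distrib_left)
  qed
  have "(\<Sum>i<m. fls_compose_power (?G i) m * fls_X ^ i) $$ n = (\<Sum>i<m. if i = nat (n mod int m) then h $$ n else 0)"
    unfolding fls_sum_nth
  proof (rule sum.cong[OF refl])
    fix i assume "i \<in> {..<m}"
    then have i: "i < m" by simp
    have e: "(fls_compose_power (?G i) m * fls_X ^ i) $$ n = fls_compose_power (?G i) m $$ (n - int i)"
      by (simp only: fls_X_power_times_conv_shift) simp
    show "(fls_compose_power (?G i) m * fls_X ^ i) $$ n = (if i = nat (n mod int m) then h $$ n else 0)"
    proof (cases "int m dvd n - int i")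
      case True
      then have "n mod int m = int i" using i by (metis mod_eq_dvd_iff mod_pos_pos_trivial of_nat_0_le_iff of_nat_less_iff)
      then show ?thesis unfolding e fls_nth_compose_power[OF m] G[OF i] using True by simp
    next
      case False
      then have "i \<noteq> nat (n mod int m)" using m by (metis dvd_minus_mod nat_0_le of_nat_0_less_iff pos_mod_sign)
      then show ?thesis unfolding e fls_nth_compose_power[OF m] using False by simp
    qed
  qed
  also have "\<dots> = h $$ n" using m by (simp add: nat_less_iff)
  finally show "h $$ n = (\<Sum>i<m. fls_compose_power (?G i) m * fls_X ^ i) $$ n" ..
qed

lemma vector_space_compose_power:
  "m > 0 \<Longrightarrow> vector_space (\<lambda>h v. fls_compose_power h m * v :: 'k::field fls)"
  by unfold_locales (auto simp: algebra_simps)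

text \<open>
  The adic topology of \<open>\<Bbbk>((x\<^bsup>1/m\<^esup>))\<close> over \<open>\<Bbbk>((x))\<close> is the order topology, whatever \<open>m\<close> is; transport along a map \<open>T\<close>
  that preserves orders does not change it.  Hence the \<open>\<theta>\<close>-adic and the \<open>z\<close>-adic topology agree.
\<close>

lemma adic_open_iff_order_open:
  fixes T :: "'k::field fls \<Rightarrow> 'k fls"
  assumes m: "m > 0" and bij: "bij T" and add: "\<And>v w. T (v + w) = T v + T w"
    and ord: "\<And>N v. ord_ge N (T v) \<longleftrightarrow> ord_ge N v"
  defines "s \<equiv> \<lambda>h v. T (fls_compose_power h m * inv T v)"
  shows "adic_open s U \<longleftrightarrow> (\<forall>v\<in>U. \<exists>M. \<forall>w. ord_ge M w \<longrightarrow> v + w \<in> U)"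
proof
  have inv: "inv T (T v) = v" "T (inv T w) = w" for v w
    using bij by (simp_all add: bij_is_inj bij_is_surj surj_f_inv_f)
  have zero: "T 0 = 0" using add[of 0 0] by (metis add_cancel_right_left add_0)
  have sum: "T (\<Sum>i\<in>A. f i) = (\<Sum>i\<in>A. T (f i))" for f and A :: "'i set"
    by (induction A rule: infinite_finite_induct) (auto simp: zero add)
  {
    assume U: "adic_open s U"
    \<comment> \<open>One spanning set suffices to produce a neighbourhood given by orders.\<close>
    define B where "B = T ` (\<lambda>i. fls_X ^ i) ` {..<m}"
    have B: "finite_spanning s B"
      unfolding s_def B_def
      by (intro finite_spanning_transport[OF vector_space_compose_power[OF m]] bij add finite_spanning_monomials m)
    show "\<forall>v\<in>U. \<exists>M. \<forall>w. ord_ge M w \<longrightarrow> v + w \<in> U"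
    proof
      fix v assume "v \<in> U"
      then obtain N where N: "(\<lambda>w. v + w) ` lattice_power s B N \<subseteq> U"
        using U B unfolding adic_open_def by blast
      have "v + w \<in> U" if "ord_ge (int (m * N)) w" for w
      proof -
        define h where "h = inv T w"
        have h: "ord_ge (int (m * N)) h" using that ord[of _ h] by (simp add: h_def inv)
        define c where "c i = Abs_fps (\<lambda>n. h $$ (int (m * (N + n) + i)))" for i
        define e where "e i = T (fls_X ^ i)" for i
        have "inj_on e {..<m}"
        proof (rule inj_onI)
          fix i j assume "e i = e j"
          then have "(fls_X ^ i :: 'k fls) = fls_X ^ j" using inv(1) unfolding e_def by metis
          then have "fls_subdegree (fls_X ^ i :: 'k fls) = fls_subdegree (fls_X ^ j :: 'k fls)" by simp
          then show "i = j" by simp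
        qed
        then have idx: "the_inv_into {..<m} e (e i) = i" if "i < m" for i
          using that by (intro the_inv_into_f_f) auto
        have "w = T h" by (simp add: h_def inv)
        also have "\<dots> = (\<Sum>i<m. T (fls_compose_power (fls_X ^ N * fps_to_fls (c i)) m * fls_X ^ i))"
          unfolding c_def by (subst monomial_decomposition[OF m h]) (rule sum)
        also have "\<dots> = (\<Sum>i<m. s (fls_X ^ N * fps_to_fls (c (the_inv_into {..<m} e (e i)))) (e i))"
          by (intro sum.cong refl) (simp only: idx lessThan_iff, simp only: s_def e_def inv)
        also have "\<dots> = (\<Sum>b\<in>B. s (fls_X ^ N * fps_to_fls (c (the_inv_into {..<m} e b))) b)"
          using \<open>inj_on e {..<m}\<close> by (simp add: B_def image_image e_def[symmetric] sum.reindex)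
        finally have "w \<in> lattice_power s B N"
          unfolding lattice_power_def by (auto intro!: exI[of _ "\<lambda>b. c (the_inv_into {..<m} e b)"])
        then show ?thesis using N by blast
      qed
      then show "\<exists>M. \<forall>w. ord_ge M w \<longrightarrow> v + w \<in> U" by blast
    qed
  next
    assume U: "\<forall>v\<in>U. \<exists>M. \<forall>w. ord_ge M w \<longrightarrow> v + w \<in> U"
    show "adic_open s U" unfolding adic_open_def
    proof (intro ballI allI impI)
      fix v B assume v: "v \<in> U" and B: "finite_spanning s B"
      obtain M where M: "\<And>w. ord_ge M w \<Longrightarrow> v + w \<in> U" using U v by blast
      have "finite B" using B by (simp add: finite_spanning_def)
      \<comment> \<open>The orders of the finitely many elements of an arbitrary spanning set are bounded below.\<close>
      then have "\<exists>L. \<forall>b\<in>B. ord_ge L (inv T b)"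
      proof (induction B)
        case (insert b B)
        then obtain L where "\<forall>b\<in>B. ord_ge L (inv T b)" by blast
        then have "\<forall>x\<in>insert b B. ord_ge (min L (fls_subdegree (inv T b))) (inv T x)"
          by (auto intro: ord_ge_mono ord_ge_mono[OF ord_ge_subdegree])
        then show ?case by (rule exI)
      qed simp
      then obtain L where L: "\<And>b. b \<in> B \<Longrightarrow> ord_ge L (inv T b)" by blast
      define N where "N = nat (M - L)"
      have "v + w \<in> U" if w: "w \<in> lattice_power s B N" for w
      proof (rule M)
        obtain c where c: "w = (\<Sum>b\<in>B. s (fls_X ^ N * fps_to_fls (c b)) b)"
          using w by (auto simp: lattice_power_def)
        have term_ord: "ord_ge M (s (fls_X ^ N * fps_to_fls (c b)) b)" if "b \<in> B" for b
        proof -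
          have "fls_compose_power (fls_X ^ N * fps_to_fls (c b)) m =
              fls_X_intpow (int (m * N)) * fps_to_fls (c b oo fps_X ^ m)"
            using m by (simp add: fls_compose_power_fps_to_fls fls_X_power_conv_shift_1)
          then have "ord_ge (int (m * N) + 0 + L) (fls_compose_power (fls_X ^ N * fps_to_fls (c b)) m * inv T b)"
            using L[OF that] by (metis ord_ge_mult ord_ge_X_intpow_mult ord_ge_fps)
          moreover have "M \<le> int (m * N) + 0 + L"
          proof -
            have "N \<le> m * N" using m by simp
            then have "int N \<le> int (m * N)" by (simp only: of_nat_le_iff)
            then show ?thesis by (simp only: N_def)
          qed
          ultimately show ?thesis unfolding s_def ord by (rule ord_ge_mono)
        qed
        show "ord_ge M w"
          unfolding c ord_ge_def fls_sum_nth using term_ord by (auto simp: ord_ge_def intro!: sum.neutral)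
      qed
      then show "\<exists>N. (\<lambda>w. v + w) ` lattice_power s B N \<subseteq> U" by blast
    qed
  }
qed

section \<open>The action of \<open>z\<close>\<close>

text \<open>
  An action of \<open>z\<close> is determined on polynomials in \<open>z\<close> by \<open>\<Phi>\<close>.  The value at \<open>z\<^sup>N r\<close> tends to \<open>0\<close> with growing
  \<open>N\<close>, since the topology is the given one, so power series are determined as well; dividing by a
  power of \<open>z\<close> settles Laurent series.
\<close>

lemma z_action_unique:
  fixes D :: "('k::field_char_0, 'k fls) fls_module"
  assumes act: "z_action D act" and act': "z_action D act'"
    and top: "\<And>U. (\<And>v. v \<in> U \<Longrightarrow> \<exists>M. \<forall>w. ord_ge M w \<longrightarrow> v + w \<in> U) \<Longrightarrow> adic_open (fst D) U"
  shows "act = act'"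
proof -
  have poly: "vector_space a" "a fls_X v = snd D v" "a (fls_const c) v = fst D (fls_const c) v"
    if "z_action D a" for a c v
    using that by (auto simp: z_action_def)
  have small: "\<exists>N. \<forall>r. ord_ge M (a (fls_X ^ N * fps_to_fls r) v)" if a: "z_action D a" for a M v
  proof -
    interpret vector_space a using a by (rule poly)
    define U where "U = {w :: 'k fls. ord_ge M w}"
    have "adic_open (fst D) U"
      by (rule top) (auto simp: U_def intro!: exI[of _ M] ord_ge_add)
    then have U: "adic_open a U"
      using a by (metis z_action_def openin_adic_topology)
    \<comment> \<open>Adding \<open>v\<close> to a spanning set puts the multiples \<open>z\<^sup>N r v\<close> into the lattice that it generates.\<close>
    obtain B where B: "finite_spanning a B" using a by (auto simp: z_action_def)
    have B': "finite_spanning a (insert v B)"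
      using B span_mono[of B "insert v B"] by (auto simp: finite_spanning_def)
    have "0 \<in> U" by (simp add: U_def ord_ge_def)
    then obtain N where N: "(\<lambda>w. 0 + w) ` lattice_power a (insert v B) N \<subseteq> U"
      using U B' unfolding adic_open_def by blast
    have "ord_ge M (a (fls_X ^ N * fps_to_fls r) v)" for r
    proof -
      have "a (fls_X ^ N * fps_to_fls r) v =
          (\<Sum>b\<in>insert v B. if b = v then a (fls_X ^ N * fps_to_fls r) v else 0)"
        using B by (subst sum.delta) (auto simp: finite_spanning_def)
      also have "\<dots> = (\<Sum>b\<in>insert v B. a (fls_X ^ N * fps_to_fls (if b = v then r else 0)) b)"
        by (rule sum.cong) auto
      finally have "a (fls_X ^ N * fps_to_fls r) v \<in> lattice_power a (insert v B) N"
        unfolding lattice_power_def by (auto intro!: exI[of _ "\<lambda>b. if b = v then r else 0"])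
      then show ?thesis using N by (auto simp: U_def)
    qed
    then show ?thesis by blast
  qed
  interpret a: vector_space act using act by (rule poly)
  interpret a': vector_space act' using act' by (rule poly)
  have X_power: "act (fls_X ^ n) v = act' (fls_X ^ n) v" for n v
  proof (induction n)
    case (Suc n)
    have "act (fls_X ^ Suc n) v = act fls_X (act (fls_X ^ n) v)"
         "act' (fls_X ^ Suc n) v = act' fls_X (act' (fls_X ^ n) v)"
      by (simp_all only: power_Suc a.scale_scale a'.scale_scale)
    then show ?case by (simp only: Suc poly(2)[OF act] poly(2)[OF act'])
  qed simp
  have fps: "act (fps_to_fls r) v = act' (fps_to_fls r) v" for r v
  proof -
    have tail: "act (fps_to_fls r) v - act' (fps_to_fls r) v =
        act (fls_X ^ N * fps_to_fls (fps_shift N r)) v - act' (fls_X ^ N * fps_to_fls (fps_shift N r)) v" for N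
    proof (induction N)
      case (Suc N)
      have "fps_shift N r = fps_const (r $ N) + fps_X * fps_shift (Suc N) r"
        by (rule fps_ext) (auto simp: fps_X_mult_nth)
      then have eq: "fls_X ^ N * fps_to_fls (fps_shift N r) =
          fls_const (r $ N) * fls_X ^ N + fls_X ^ Suc N * fps_to_fls (fps_shift (Suc N) r)"
        by (simp add: fls_times_fps_to_fls algebra_simps)
      have "act (fls_const (r $ N) * fls_X ^ N) v = act' (fls_const (r $ N) * fls_X ^ N) v"
        by (simp add: a.scale_scale[symmetric] a'.scale_scale[symmetric] X_power poly(3)[OF act] poly(3)[OF act']
            del: a.scale_scale a'.scale_scale)
      then show ?case unfolding Suc eq by (simp add: a.scale_left_distrib a'.scale_left_distrib)
    qed simp
    have "ord_ge M (act (fps_to_fls r) v - act' (fps_to_fls r) v)" for M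
    proof -
      obtain N N' where N: "\<And>r. ord_ge M (act (fls_X ^ N * fps_to_fls r) v)"
        "\<And>r. ord_ge M (act' (fls_X ^ N' * fps_to_fls r) v)"
        using small[OF act] small[OF act'] by meson
      define L where "L = max N N'"
      have split: "fls_X ^ L * fps_to_fls w = fls_X ^ K * fps_to_fls (fps_X ^ (L - K) * w)"
        if "K \<le> L" for K and w :: "'k fps"
        using that by (simp add: fls_times_fps_to_fls fps_to_fls_power flip: power_add mult.assoc)
      have "ord_ge M (act (fls_X ^ L * fps_to_fls (fps_shift L r)) v)"
        by (subst split[of N]) (auto simp: L_def intro: N)
      moreover have "ord_ge M (act' (fls_X ^ L * fps_to_fls (fps_shift L r)) v)"
        by (subst split[of N']) (auto simp: L_def intro: N)
      ultimately show ?thesis unfolding tail[of L] by (rule ord_ge_diff)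
    qed
    then have "(act (fps_to_fls r) v - act' (fps_to_fls r) v) $$ i = 0" for i
      by (rule ord_geD[of "i + 1"]) simp
    then show ?thesis by (metis eq_iff_diff_eq_0 fls_eqI fls_zero_nth)
  qed
  have "act h v = act' h v" for h v
  proof -
    define n where "n = nat (- fls_subdegree h)"
    have "ord_ge 0 (fls_X ^ n * h)"
      using ord_ge_subdegree[of h] by (auto simp: ord_ge_def n_def fls_X_power_times_conv_shift)
    then obtain r where "fls_X ^ n * h = fls_X_intpow 0 * fps_to_fls r" by (rule ord_ge_obtain_fps)
    then have r: "fls_X ^ n * h = fps_to_fls r" by simp
    have "act (fls_X ^ n) (act h v) = act' (fls_X ^ n) (act' h v)"
      using fps[of r v] by (simp only: r[symmetric] a.scale_scale a'.scale_scale)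
    then have "act (fls_X ^ n) (act h v) = act (fls_X ^ n) (act' h v)" by (simp add: X_power)
    then show ?thesis by (rule a.scale_left_imp_eq[rotated]) simp
  qed
  then show ?thesis by (intro ext)
qed

lemma z_action_transport:
  fixes T :: "'k::field_char_0 fls \<Rightarrow> 'k fls"
  assumes p: "p > 0" and q: "q > 0" and bij: "bij T" and add: "\<And>v w. T (v + w) = T v + T w"
    and const: "\<And>c v. T (fls_const c * v) = fls_const c * T v"
    and ord: "\<And>N v. ord_ge N (T v) \<longleftrightarrow> ord_ge N v"
    and Phi: "\<And>h. T (fls_X_intpow (int p) * h) = g * phi q (T h)"
  shows "(THE act. z_action (D_obj q g) act) = (\<lambda>h v. T (fls_compose_power h p * inv T v))"
proof (rule the_equality)
  have inv: "inv T (T v) = v" "T (inv T w) = w" for v w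
    using bij by (simp_all add: bij_is_inj bij_is_surj surj_f_inv_f)
  have id: "adic_open (\<lambda>h v. fls_compose_power h q * v) U \<longleftrightarrow> (\<forall>v\<in>U. \<exists>M. \<forall>w. ord_ge M w \<longrightarrow> v + w \<in> U)"
    for U :: "'k fls set"
    using adic_open_iff_order_open[OF q bij_id, of U] by (simp add: inv_id)
  show z: "z_action (D_obj q g) (\<lambda>h v. T (fls_compose_power h p * inv T v))"
    unfolding z_action_def
  proof (intro conjI allI)
    show "vector_space (\<lambda>h v. T (fls_compose_power h p * inv T v))"
      by (intro transport_module(1) vector_space_compose_power p bij add)
    show "\<exists>B. finite_spanning (\<lambda>h v. T (fls_compose_power h p * inv T v)) B"
      using finite_spanning_transport[OF vector_space_compose_power[OF p] bij add finite_spanning_monomials[OF p]]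
      by blast
    show "T (fls_compose_power (fls_const c) p * inv T v) = fst (D_obj q g) (fls_const c) v" for c v
      using p q by (simp add: D_obj_def const inv)
    show "T (fls_compose_power fls_X p * inv T v) = snd (D_obj q g) v" for v
      using p Phi[of "inv T v"] by (simp add: D_obj_def inv)
    show "adic_topology (\<lambda>h v. T (fls_compose_power h p * inv T v)) = adic_topology (fst (D_obj q g))"
      unfolding adic_topology_def
      by (intro arg_cong[of _ _ topology] ext)
         (simp only: adic_open_iff_order_open[OF p bij add ord] D_obj_def fst_conv id)
  qed
  show "act = (\<lambda>h v. T (fls_compose_power h p * inv T v))" if "z_action (D_obj q g) act" for act
    by (rule z_action_unique[OF that z]) (simp add: D_obj_def id)
qed

text \<open>
  The equation for \<open>T\<close> says \<open>\<theta> \<Phi> T(\<nabla> h) = - T h\<close> for the connection \<open>\<nabla>\<close> of \<open>E\<^sub>f\<close>, that is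
  \<open>T \<nabla> = - (\<theta> \<Phi>)\<^sup>-\<^sup>1 T\<close>.
\<close>

lemma connection_iso_of_intertwiner:
  fixes T :: "'k::field_char_0 fls \<Rightarrow> 'k fls"
  assumes p: "p > 0" and q: "q > 0" and g: "g \<noteq> 0" and bij: "bij T"
    and add: "\<And>v w. T (v + w) = T v + T w"
    and const: "\<And>c v. T (fls_const c * v) = fls_const c * T v"
    and ord: "\<And>N v. ord_ge N (T v) \<longleftrightarrow> ord_ge N v"
    and Phi: "\<And>h. T (fls_X_intpow (int p) * h) = g * phi q (T h)"
    and nabla: "\<And>h. T (fls_const (1 / of_nat p) * (fls_X * fls_deriv h) + f * h) = - (fls_X_intpow (- int q) * T h)"
  shows "connection_iso (inverse_mellin (D_obj q g)) (E_obj p f)"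
proof -
  have inv: "inv T (T v) = v" "T (inv T w) = w" for v w
    using bij by (simp_all add: bij_is_inj bij_is_surj surj_f_inv_f)
  have zero: "T 0 = 0" using const[of 0 0] by simp
  have uminus: "T (- v) = - T v" for v using add[of v "- v"] by (simp add: zero eq_neg_iff_add_eq_0 add.commute)
  define n where "n v = deriv_z p v + inverse (fls_X ^ p) * f * v" for v
  have zn: "fls_X_intpow (int p) * n v = fls_const (1 / of_nat p) * (fls_X * fls_deriv v) + f * v" for v
  proof -
    \<comment> \<open>\<open>z d/dz = (s/p) d/ds\<close>, in variables that stand for \<open>s\<close>, \<open>s\<^bsup>p-1\<^esup>\<close> and \<open>p\<close>.\<close>
    have cancel: "x * y * (d / (c * y) + inverse (x * y) * e) = inverse c * (x * d) + e"
      if "x \<noteq> 0" "y \<noteq> 0" "c \<noteq> 0" for x y c d e :: "'k fls"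
      using that by (simp add: field_simps)
    have "fls_deriv (fls_X ^ p :: 'k fls) = fls_const (of_nat p) * fls_X ^ (p - 1)"
      by (simp add: fls_deriv_power fls_of_nat)
    moreover have "(fls_X :: 'k fls) ^ p = fls_X * fls_X ^ (p - 1)" using p by (cases p) simp_all
    moreover have "fls_X_intpow (int p) = (fls_X :: 'k fls) ^ p" by (simp add: fls_X_power_conv_shift_1)
    moreover have "fls_const (1 / of_nat p) = inverse (fls_const (of_nat p :: 'k))"
      using p by (intro inverse_unique[symmetric]) simp
    ultimately show ?thesis
      using cancel[of fls_X "fls_X ^ (p - 1)" "fls_const (of_nat p)" "fls_deriv v" "f * v"] p
      by (simp add: n_def deriv_z_def mult.assoc)
  qed
  define M where "M u = fls_X_intpow (int q) * (g * phi q u)" for u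
  interpret difference_module "fst (D_obj q g)" "snd (D_obj q g)"
    using q g by (rule difference_module_D_obj)
  have inj: "inj (\<lambda>u. g * phi q u)" using bij_Phi by (simp add: D_obj_def bij_is_inj)
  have "inj M"
  proof (rule injI)
    fix u v assume "M u = M v"
    then have "g * phi q u = g * phi q v" by (simp only: M_def mult_left_cancel[OF fls_X_intpow_nonzero])
    then show "u = v" by (rule injD[OF inj])
  qed
  have "M (T (- n (inv T v))) = v" for v
  proof -
    have "M (T (- n (inv T v))) = fls_X_intpow (int q) * - T (fls_X_intpow (int p) * n (inv T v))"
      unfolding M_def Phi[symmetric] by (simp only: mult_minus_right uminus)
    also have "\<dots> = fls_X_intpow (int q) * fls_X_intpow (- int q) * v"
      unfolding zn nabla by (simp add: inv)
    finally show ?thesis by (simp only: fls_X_intpow_times_fls_X_intpow) simp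
  qed
  then have "inv M v = T (- n (inv T v))" for v using \<open>inj M\<close> by (metis inv_f_f)
  moreover have "(\<lambda>u. fls_X_intpow (int q) * (g * phi q u)) = M"
    by (simp add: M_def fun_eq_iff)
  ultimately have "inverse_mellin (D_obj q g) = (\<lambda>h v. T (fls_compose_power h p * inv T v), \<lambda>v. T (n (inv T v)))"
    unfolding inverse_mellin_def z_action_transport[OF p q bij add const ord Phi]
    using q by (simp add: D_obj_def uminus)
  moreover have "E_obj p f = (\<lambda>h v. fls_compose_power h p * v, n)"
    unfolding E_obj_def n_def ..
  ultimately show ?thesis
    using connection_transport[OF _ bij add, of "\<lambda>h v. fls_compose_power h p * v" n] connection_E_obj[OF p, of f]
    by (simp only: fst_conv snd_conv)
qed

section \<open>Solutions of the system\<close>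

lemma fps_inv_nths:
  fixes \<tau> :: "'k::field fps"
  assumes "\<tau> $ 0 = 0" "\<tau> $ 1 \<noteq> 0"
  shows "fps_inv \<tau> $ 0 = 0" "\<tau> $ 1 * fps_inv \<tau> $ 1 = 1"
proof -
  show 0: "fps_inv \<tau> $ 0 = 0" by (simp add: fps_inv_def)
  have "(fps_inv \<tau> oo \<tau>) $ 1 = (fps_X :: 'k fps) $ 1" by (simp only: fps_inv[OF assms])
  then show "\<tau> $ 1 * fps_inv \<tau> $ 1 = 1" using 0 by (simp add: fps_compose_nth mult.commute)
qed

text \<open>
  Differentiating \<open>w\<^sup>p = 1\<close> gives \<open>p w\<^bsup>p-1\<^esup> w' = 0\<close>.
\<close>

lemma fps_power_eq_one_const:
  fixes w :: "'k::field_char_0 fps"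
  assumes "w ^ p = 1" "p > 0"
  shows "w = fps_const (w $ 0)" "(w $ 0) ^ p = 1"
proof -
  have "w \<noteq> 0" using assms by (auto simp: power_0_left)
  have "fps_deriv (w ^ p) = 0" by (simp add: assms(1))
  then have "fps_deriv w = 0"
    using \<open>w \<noteq> 0\<close> assms(2) unfolding fps_deriv_power' by (simp del: fps_deriv_eq_0_iff)
  then show "w = fps_const (w $ 0)" by (simp add: fps_deriv_eq_0_iff)
  show "(w $ 0) ^ p = 1" using arg_cong[OF assms(1), of "\<lambda>x. x $ 0"] by (simp add: fps_power_zeroth)
qed

lemma fps_dvd_compose_diff:
  fixes u v F :: "'k::field fps"
  assumes "u $ 0 = 0" "v $ 0 = 0" "fps_X ^ M dvd u - v"
  shows "fps_X ^ M dvd (F oo u) - (F oo v)"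
proof -
  have dvd_iff: "fps_X ^ M dvd x \<longleftrightarrow> (\<forall>n<M. x $ n = 0)" for x :: "'k fps"
  proof
    assume "\<forall>n<M. x $ n = 0"
    then have "x = fps_X ^ M * fps_shift M x" by (intro fps_ext) (auto simp: fps_X_power_mult_nth)
    then show "fps_X ^ M dvd x" by (rule dvdI)
  qed (auto simp: fps_X_power_mult_nth elim!: dvdE)
  have "fps_X ^ M dvd u ^ i - v ^ i" for i
    using assms(3) by (simp add: power_diff_sumr2)
  then have "(u ^ i) $ n = (v ^ i) $ n" if "n < M" for i n
    using that by (auto simp: dvd_iff)
  then show ?thesis unfolding dvd_iff by (simp add: fps_compose_nth)
qed

lemma galois_nth:
  "\<eta> \<noteq> 0 \<Longrightarrow> galois \<eta> v $$ n = v $$ n * \<eta> powi n" for \<eta> :: "'k::field"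
  unfolding galois_def by (rule fls_nth_fls_compose_fps_linear)

lemma galois_galois:
  fixes v :: "'k::field fls"
  assumes "\<eta> \<noteq> 0" "\<epsilon> \<noteq> 0"
  shows "galois \<eta> (galois \<epsilon> v) = galois (\<epsilon> * \<eta>) v"
  by (rule fls_eqI) (use assms in \<open>simp add: galois_nth power_int_mult_distrib\<close>)

lemma R_class_galois:
  fixes f :: "'k::field_char_0 fls"
  assumes p: "p > 0" and \<epsilon>: "\<epsilon> ^ p = 1"
  shows "R_class p (galois \<epsilon> f) = R_class p f"
proof -
  have nz: "\<eta> \<noteq> 0" if "\<eta> ^ p = 1" for \<eta> :: 'k using that p by (auto simp: power_0_left)
  have "R_class p (galois \<epsilon> f) \<subseteq> R_class p f" if "\<epsilon> ^ p = 1" for \<epsilon> and f :: "'k fls"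
  proof
    fix x assume "x \<in> R_class p (galois \<epsilon> f)"
    then obtain \<eta> n r where \<eta>: "\<eta> ^ p = 1"
      "x = galois \<eta> (galois \<epsilon> f) + fls_const (of_int n / of_nat p) + fls_X * fps_to_fls r"
      unfolding R_class_def by blast
    moreover have "(\<epsilon> * \<eta>) ^ p = 1" using \<eta> that by (simp add: power_mult_distrib)
    ultimately show "x \<in> R_class p f"
      using galois_galois[of \<eta> \<epsilon> f] nz that unfolding R_class_def by auto
  qed
  moreover have "galois (inverse \<epsilon>) (galois \<epsilon> f) = f"
    using nz[OF \<epsilon>] by (intro fls_eqI) (simp add: galois_nth power_int_inverse)
  moreover have "inverse \<epsilon> ^ p = 1" using \<epsilon> by (simp add: power_inverse)
  ultimately show ?thesis using \<epsilon> by (metis subset_antisym)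
qed

text \<open>
  \<open>H\<close> is the left-hand side \<open>g + a (p+q)/(2q) \<theta>\<^bsup>1+p/q\<^esup>\<close> of the first equation, as a power series in \<open>t = \<theta>\<^bsup>1/q\<^esup>\<close>, and
  \<open>K\<close> is its unit part.
\<close>

locale mellin_system =
  fixes p q :: nat and a :: "'k::field_char_0" and g :: "'k fls" and K0 :: "'k fps"
  assumes p: "p > 0" and q: "q > 0" and a: "a \<noteq> 0"
    and g: "g = fls_X ^ p * fps_to_fls K0" and K0: "K0 $ 0 = a"
begin

definition K :: "'k fps" where
  "K = K0 + fps_const (a * (of_nat (p + q) / of_nat (2 * q))) * fps_X ^ q"

definition H :: "'k fps" where "H = fps_X ^ p * K"

lemma K_nth_0: "K $ 0 = a" using q by (simp add: K_def K0)

lemma H_fls: "fps_to_fls H = g + fls_const (a * (of_nat (p + q) / of_nat (2 * q))) * fls_X ^ (q + p)"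
  by (simp add: H_def K_def g fls_times_fps_to_fls fps_to_fls_power power_add algebra_simps)

lemma solves_system_iff:
  "solves_system p q a g f \<longleftrightarrow>
     (\<exists>\<tau>. \<tau> $ 0 = 0 \<and> H oo \<tau> = fps_X ^ p \<and> f = - inverse (fps_to_fls \<tau> ^ q))"
proof -
  have "fls_compose_fps (fps_to_fls H) \<tau> = fls_X ^ p \<longleftrightarrow> H oo \<tau> = fps_X ^ p" if "\<tau> $ 0 = 0" for \<tau>
  proof -
    have "fls_compose_fps (fps_to_fls H) \<tau> = fps_to_fls (H oo \<tau>)"
      using that by (cases "\<tau> = 0") (auto simp: fls_compose_fps_0_right fls_subdegree_fls_to_fps_gt0)
    moreover have "fls_X ^ p = fps_to_fls (fps_X ^ p :: 'k fps)" by (simp add: fps_to_fls_power)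
    ultimately show ?thesis by (simp only: fps_to_fls_eq_iff)
  qed
  then show ?thesis unfolding solves_system_def H_fls[symmetric] by auto
qed

lemma H_compose:
  assumes "\<tau> $ 0 = 0"
  shows "H oo \<tau> = \<tau> ^ p * (K oo \<tau>)"
  unfolding H_def using assms by (simp add: fps_compose_mult_distrib fps_compose_power[symmetric])

lemma solution_linear:
  assumes \<tau>: "\<tau> $ 0 = 0" "H oo \<tau> = fps_X ^ p"
  shows "a * (\<tau> $ 1) ^ p = 1" "\<tau> $ 1 \<noteq> 0"
proof -
  define w where "w = fps_shift 1 \<tau>"
  have w: "\<tau> = fps_X * w" using \<tau>(1) unfolding w_def by (intro fps_ext) auto
  have "fps_X ^ p * (w ^ p * (K oo \<tau>)) = fps_X ^ p * 1"
    using \<tau> H_compose[OF \<tau>(1)] by (simp add: w power_mult_distrib mult_ac)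
  then have "w ^ p * (K oo \<tau>) = 1" by (subst (asm) mult_left_cancel) simp_all
  then have "(w ^ p * (K oo \<tau>)) $ 0 = 1" by simp
  then show "a * (\<tau> $ 1) ^ p = 1" by (simp add: K_nth_0 w_def fps_nth_power_0 mult.commute)
  then show "\<tau> $ 1 \<noteq> 0" using p by (auto simp: power_0_left)
qed

text \<open>
  A solution \<open>\<tau>\<close> is the same as the compositional inverse of a \<open>p\<close>-th root of \<open>H\<close>.
\<close>

lemma solution_inverse:
  assumes \<tau>: "\<tau> $ 0 = 0" "H oo \<tau> = fps_X ^ p"
  shows "fps_inv \<tau> ^ p = H" "(fps_inv \<tau> $ 1) ^ p = a"
proof -
  note lin = solution_linear[OF \<tau>]
  note inv = fps_inv_nths[OF \<tau>(1) lin(2)]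
  have "H oo (\<tau> oo fps_inv \<tau>) = (fps_X ^ p) oo fps_inv \<tau>"
    using fps_compose_assoc[OF inv(1) \<tau>(1), of H] \<tau>(2) by simp
  then show "fps_inv \<tau> ^ p = H"
    using \<tau>(1) lin(2) inv(1) by (simp add: fps_inv_right fps_compose_power[symmetric])
  have "(\<tau> $ 1 * fps_inv \<tau> $ 1) ^ p = 1" by (simp only: inv) simp
  then have "(\<tau> $ 1) ^ p * (fps_inv \<tau> $ 1) ^ p = a * (\<tau> $ 1) ^ p" by (simp only: power_mult_distrib lin(1))
  then show "(fps_inv \<tau> $ 1) ^ p = a" using lin(2) by simp
qed

lemma solution_exists:
  assumes b: "b ^ p = a"
  shows "\<exists>f. solves_system p q a g f"
proof -
  have b0: "b \<noteq> 0" using b a p by (auto simp: power_0_left)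
  define y where "y = fps_const (1 / a) * K - 1"
  have y0: "y $ 0 = 0" using a by (simp add: y_def K_nth_0)
  have K: "K = fps_const a * (1 + y)" using a by (simp add: y_def flip: mult.assoc)
  define \<sigma> where "\<sigma> = fps_const b * fps_X * (fps_binomial (1 / of_nat p) oo y)"
  have \<sigma>: "\<sigma> $ 0 = 0" "\<sigma> $ 1 \<noteq> 0" using b0 by (simp_all add: \<sigma>_def mult.assoc)
  have "(fps_binomial (1 / of_nat p) oo y) ^ p = fps_binomial 1 oo y"
    using p by (simp add: fps_compose_power[OF y0] fps_binomial_power)
  also have "\<dots> = 1 + y"
    using fps_binomial_of_nat[of 1, where ?'a = 'k] by (simp add: fps_compose_add_distrib y0)
  finally have "\<sigma> ^ p = H"
    by (simp add: \<sigma>_def H_def K power_mult_distrib b mult_ac)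
  moreover have "(\<sigma> ^ p) oo fps_inv \<sigma> = fps_X ^ p"
    using \<sigma> fps_inv_nths[OF \<sigma>] by (simp add: fps_compose_power[symmetric] fps_inv_right)
  ultimately show ?thesis unfolding solves_system_iff using fps_inv_nths(1)[OF \<sigma>] by auto
qed

text \<open>
  Two \<open>p\<close>-th roots of \<open>H\<close> differ by a \<open>p\<close>-th root of unity \<open>\<epsilon>\<close>, so two solutions differ by the substitution
  \<open>s \<mapsto> \<epsilon> s\<close>, an element of the Galois group.
\<close>

lemma solution_unique:
  assumes f: "solves_system p q a g f" and f': "solves_system p q a g f'"
  shows "R_class p f = R_class p f'"
proof -
  obtain \<tau> \<tau>' where \<tau>: "\<tau> $ 0 = 0" "H oo \<tau> = fps_X ^ p" and f: "f = - inverse (fps_to_fls \<tau> ^ q)"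
    and \<tau>': "\<tau>' $ 0 = 0" "H oo \<tau>' = fps_X ^ p" and f': "f' = - inverse (fps_to_fls \<tau>' ^ q)"
    using assms unfolding solves_system_iff by blast
  note lin = solution_linear[OF \<tau>]
  define \<sigma> where "\<sigma> = fps_inv \<tau>"
  note inv = fps_inv_nths[OF \<tau>(1) lin(2), folded \<sigma>_def]
  define w where "w = fps_shift 1 (\<sigma> oo \<tau>')"
  have w: "\<sigma> oo \<tau>' = fps_X * w" unfolding w_def by (intro fps_ext) (auto simp: inv)
  have "(\<sigma> oo \<tau>') ^ p = fps_X ^ p"
    using solution_inverse(1)[OF \<tau>] \<tau>' fps_compose_power[OF \<tau>'(1), of \<sigma> p] by (simp add: \<sigma>_def)
  then have "fps_X ^ p * w ^ p = fps_X ^ p * 1" by (simp add: w power_mult_distrib)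
  then have "w ^ p = 1" by (subst (asm) mult_left_cancel) simp_all
  note \<epsilon> = fps_power_eq_one_const[OF this p]
  define \<epsilon> where "\<epsilon> = w $ 0"
  have \<epsilon>0: "\<epsilon> \<noteq> 0" using \<epsilon>(2) p by (auto simp: \<epsilon>_def power_0_left)
  have "\<tau> oo (\<sigma> oo \<tau>') = \<tau>'"
    using fps_compose_assoc[OF \<tau>'(1) inv(1), of \<tau>] \<tau>(1) \<tau>'(1) lin(2)
    by (simp add: \<sigma>_def fps_inv_right fps_X_fps_compose_startby0)
  then have "\<tau>' = \<tau> oo (fps_const \<epsilon> * fps_X)" using w \<epsilon>(1) by (metis \<epsilon>_def mult.commute)
  then have "f' = galois \<epsilon> f"
    unfolding f f' galois_def using \<epsilon>0
    by (simp add: fls_compose_fps_inverse fls_compose_fps_power)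
  then show ?thesis using R_class_galois[OF p, of \<epsilon> f] \<epsilon>(2) by (simp add: \<epsilon>_def)
qed

lemma solution_connection_iso:
  assumes "solves_system p q a g f"
  shows "connection_iso (inverse_mellin (D_obj q g)) (E_obj p f)"
proof -
  obtain \<tau> where \<tau>: "\<tau> $ 0 = 0" "H oo \<tau> = fps_X ^ p" and f: "f = - inverse (fps_to_fls \<tau> ^ q)"
    using assms unfolding solves_system_iff by blast
  note lin = solution_linear[OF \<tau>]
  define \<sigma> where "\<sigma> = fps_inv \<tau>"
  note inv = fps_inv_nths[OF \<tau>(1) lin(2), folded \<sigma>_def]
  note \<sigma>p = solution_inverse[OF \<tau>, folded \<sigma>_def]
  have \<sigma>1: "\<sigma> $ 1 \<noteq> 0" using inv(2) by auto
  have g_ord: "ord_ge (int p) g" "g $$ int p = (\<sigma> $ 1) ^ p"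
    unfolding \<sigma>p(2) by (simp_all add: g fls_X_power_times_conv_shift ord_ge_def K0)
  then have g0: "g \<noteq> 0" using \<sigma>p(2) a by auto
  interpret difference_operator p q g "\<sigma> $ 1"
    using p q \<sigma>1 g_ord by unfold_locales
  have power: "fps_to_fls \<sigma> ^ p = g + fls_const ((\<sigma> $ 1) ^ p * (of_nat (p + q) / of_nat (2 * q))) * fls_X_intpow (int (p + q))"
    unfolding fps_to_fls_power[symmetric] \<sigma>p H_fls by (simp add: fls_X_power_conv_shift_1 add.commute)
  have "f = - (fps_to_fls \<tau> powi (- int q))" by (simp add: f power_int_minus)
  then have f_ord: "ord_ge (- int q) f"
    using ord_ge_linear_fps_powi(1)[OF \<tau>(1) lin(2)] by (simp add: ord_ge_uminus)
  have "\<sigma> \<noteq> 0" using \<sigma>1 by auto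
  then have "fls_compose_fps f \<sigma> = - inverse (fps_to_fls (\<tau> oo \<sigma>) ^ q)"
    unfolding f using inv(1) \<open>\<sigma> \<noteq> 0\<close> by (simp add: fls_compose_fps_inverse fls_compose_fps_power)
  also have "\<dots> = - (fls_X powi (- int q))"
    unfolding \<sigma>_def fps_inv_right[OF \<tau>(1) lin(2)] by (simp add: power_int_minus del: fls_X_powi)
  finally have f_comp: "fls_compose_fps f \<sigma> = - fls_X_intpow (- int q)" by simp
  obtain T where T: "filtered_map T 0" "bij T" "\<forall>N h. ord_ge N (T h) \<longleftrightarrow> ord_ge N h"
    "\<forall>h. T (fls_X_intpow (int p) * h) = Phi (T h)"
    "\<forall>h. T (fls_const (1 / of_nat p) * (fls_X * fls_deriv h) + f * h) = - (fls_X_intpow (- int q) * T h)"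
    using intertwiner_solution[OF inv(1) refl power f_ord f_comp] by (elim exE conjE)
  interpret T: filtered_map T 0 by fact
  have Phi: "T (fls_X_intpow (int p) * h) = g * phi q (T h)" for h
    using T(4) unfolding Phi_def by (rule spec)
  have nabla: "T (fls_const (1 / of_nat p) * (fls_X * fls_deriv h) + f * h) = - (fls_X_intpow (- int q) * T h)" for h
    using T(5) by (rule spec)
  show ?thesis
  proof (rule connection_iso_of_intertwiner[OF p q g0 T(2)])
    show "ord_ge N (T v) \<longleftrightarrow> ord_ge N v" for N v
      using T(3) by (elim allE)
  qed (fact T.add T.const_mult Phi nabla)+
qed

section \<open>Ramification\<close>

text \<open>
  A symmetry of \<open>f\<close> is inherited by \<open>g\<close>.  Let \<open>f(\<zeta> s) = f(s)\<close> modulo \<open>s \<Bbbk>[[s]]\<close>.  As \<open>f = - \<tau>\<^bsup>-q\<^esup>\<close> has order \<open>-q\<close>, taking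
  \<open>q\<close>-th roots gives \<open>\<tau>(\<zeta> s) = \<zeta> \<tau>(s)\<close> to relative order \<open>q\<close>.  Since \<open>H(\<tau>(s)) = s\<^sup>p\<close> is fixed by \<open>s \<mapsto> \<zeta> s\<close>, also
  \<open>H(\<zeta> \<tau>(s)) = H(\<tau>(s))\<close> modulo \<open>s\<^bsup>p+q+1\<^esup>\<close>, and composing with the inverse of \<open>\<tau>\<close> gives \<open>H(\<zeta> t) = H(t)\<close> modulo
  \<open>t\<^bsup>p+q+1\<^esup>\<close>.
\<close>

lemma ramification_of_solution:
  assumes f: "solves_system p q a g f"
    and \<zeta>: "\<zeta> ^ p = 1" "\<zeta> ^ q = 1" and inv: "ord_ge 1 (f - galois \<zeta> f)"
    and i: "i \<le> p + q" "\<zeta> ^ i \<noteq> 1"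
  shows "H $ i = 0"
proof -
  obtain \<tau> where \<tau>: "\<tau> $ 0 = 0" "H oo \<tau> = fps_X ^ p" and f: "f = - inverse (fps_to_fls \<tau> ^ q)"
    using f unfolding solves_system_iff by blast
  note lin = solution_linear[OF \<tau>]
  have \<zeta>0: "\<zeta> \<noteq> 0" using \<zeta>(1) p by (auto simp: power_0_left)
  define Z :: "'k fps" where "Z = fps_const \<zeta> * fps_X"
  have Z: "Z $ 0 = 0" "Z \<noteq> 0" using \<zeta>0 by (auto simp: Z_def)
  define w where "w = fps_shift 1 \<tau>"
  have w: "\<tau> = fps_X * w" using \<tau>(1) unfolding w_def by (intro fps_ext) auto
  have w0: "w $ 0 \<noteq> 0" using lin(2) by (simp add: w_def)
  define w' where "w' = w oo Z"
  have w'0: "w' $ 0 = w $ 0" by (simp add: w'_def)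
  have \<tau>Z: "\<tau> oo Z = Z * w'" by (simp add: w w'_def fps_compose_mult_distrib Z)
  have "fps_X ^ (q + 1) dvd w ^ q - w' ^ q"
  proof -
    have "galois \<zeta> f = - inverse (fps_to_fls (\<tau> oo Z) ^ q)"
      unfolding galois_def f using Z
      by (simp add: fls_compose_fps_inverse fls_compose_fps_power Z_def)
    also have "fps_to_fls (\<tau> oo Z) ^ q = fls_X ^ q * fps_to_fls w' ^ q"
      unfolding \<tau>Z by (simp add: Z_def fls_times_fps_to_fls power_mult_distrib \<zeta> fls_const_power[symmetric])
    finally have 1: "galois \<zeta> f = - inverse (fls_X ^ q * fps_to_fls w' ^ q)" .
    have 2: "f = - inverse (fls_X ^ q * fps_to_fls w ^ q)"
      by (simp add: f w fls_times_fps_to_fls power_mult_distrib)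
    have diff: "f - galois \<zeta> f = - inverse (fls_X ^ q * fps_to_fls w ^ q) - - inverse (fls_X ^ q * fps_to_fls w' ^ q)"
      by (subst 1, subst 2) (rule refl)
    have nz: "fps_to_fls w \<noteq> 0" "fps_to_fls w' \<noteq> 0" using w0 w'0 by auto
    have cancel: "y - z = x * (y * z) * (- inverse (x * y) - - inverse (x * z))"
      if "x \<noteq> 0" "y \<noteq> 0" "z \<noteq> 0" for x y z :: "'k fls" using that by (simp add: field_simps)
    have "fps_to_fls (w ^ q - w' ^ q) = fls_X ^ q * (fps_to_fls w ^ q * fps_to_fls w' ^ q) * (f - galois \<zeta> f)"
      unfolding diff fps_to_fls_minus fps_to_fls_power
      by (rule cancel) (use nz in simp_all)
    also have "\<dots> = fls_X_intpow (int q) * (fps_to_fls (w ^ q * w' ^ q) * (f - galois \<zeta> f))"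
      by (simp only: fls_times_fps_to_fls fps_to_fls_power fls_X_power_conv_shift_1 mult.assoc)
    finally have "ord_ge (int q + (0 + 1)) (fps_to_fls (w ^ q - w' ^ q))"
      by (simp only: ord_ge_X_intpow_mult) (intro ord_ge_mult ord_ge_fps inv)
    then have z: "(w ^ q - w' ^ q) $ n = 0" if "n < q + 1" for n
      using ord_geD[of "int q + (0 + 1)" "fps_to_fls (w ^ q - w' ^ q)" "int n"] that by simp
    have "w ^ q - w' ^ q = fps_X ^ (q + 1) * fps_shift (q + 1) (w ^ q - w' ^ q)"
      using z by (intro fps_ext) (simp only: fps_X_power_mult_nth fps_shift_nth, auto)
    then show ?thesis by (rule dvdI)
  qed
  moreover have "w ^ q - w' ^ q = (w - w') * (\<Sum>i<q. w' ^ (q - Suc i) * w ^ i)"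
    by (rule power_diff_sumr2)
  \<comment> \<open>\<open>w\<close> and \<open>w'\<close> have the same constant term, so the cofactor of \<open>w - w'\<close> has constant term \<open>q w(0)\<^bsup>q-1\<^esup> \<noteq> 0\<close>.\<close>
  moreover have "is_unit (\<Sum>i<q. w' ^ (q - Suc i) * w ^ i)"
  proof -
    have "(\<Sum>i<q. w' ^ (q - Suc i) * w ^ i) $ 0 = (\<Sum>i<q. (w $ 0) ^ (q - 1))"
      unfolding fps_sum_nth
      by (rule sum.cong) (simp_all add: fps_nth_power_0 w'0 flip: power_add)
    then show ?thesis using w0 q by simp
  qed
  ultimately have ww': "fps_X ^ (q + 1) dvd w - w'" by (simp add: dvd_mult_unit_iff)
  define u where "u = Z * w"
  define v where "v = Z * w'"
  have uv0: "u $ 0 = 0" "v $ 0 = 0" by (simp_all add: u_def v_def Z)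
  have XZ: "fps_X dvd Z" by (simp add: Z_def)
  have "fps_X ^ (q + 1) dvd u - v"
    unfolding u_def v_def right_diff_distrib[symmetric] using ww' by (rule dvd_mult)
  then have "fps_X ^ (q + 1) dvd (K oo u) - (K oo v)" by (rule fps_dvd_compose_diff[OF uv0])
  moreover have "fps_X ^ (q + 1) dvd w ^ p - w' ^ p"
    using ww' by (simp add: power_diff_sumr2)
  ultimately have "fps_X ^ (q + 1) dvd w ^ p * ((K oo u) - (K oo v)) + (w ^ p - w' ^ p) * (K oo v)"
    by (intro dvd_add dvd_mult dvd_mult2)
  moreover have "fps_X ^ p dvd Z ^ p" by (simp add: XZ dvd_power_same)
  ultimately have "fps_X ^ p * fps_X ^ (q + 1) dvd 
      Z ^ p * (w ^ p * ((K oo u) - (K oo v)) + (w ^ p - w' ^ p) * (K oo v))"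
    by (intro mult_dvd_mono)
  also have "\<dots> = (H oo u) - (H oo v)"
    unfolding H_compose[OF uv0(1)] H_compose[OF uv0(2)] unfolding u_def v_def
    by (simp add: power_mult_distrib algebra_simps)
  also have "H oo v = H oo \<tau>"
  proof -
    have "H oo v = (H oo \<tau>) oo Z"
      unfolding v_def \<tau>Z[symmetric] by (rule fps_compose_assoc[OF Z(1) \<tau>(1)])
    then show ?thesis by (simp add: \<tau>(2) fps_compose_power[symmetric] Z) (simp add: Z_def power_mult_distrib \<zeta>)
  qed
  also have "H oo u = (H oo Z) oo \<tau>"
    using fps_compose_assoc[OF \<tau>(1) Z(1), of H] \<tau>(1)
    by (simp add: u_def Z_def w fps_compose_mult_distrib mult.assoc)
  finally have "fps_X ^ (p + q + 1) dvd ((H oo Z) - H) oo \<tau>"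
    by (simp add: fps_compose_sub_distrib power_add mult_ac)
  then obtain R where R: "((H oo Z) - H) oo \<tau> = fps_X ^ (p + q + 1) * R" by (elim dvdE)
  define \<sigma> where "\<sigma> = fps_inv \<tau>"
  note inv = fps_inv_nths[OF \<tau>(1) lin(2), folded \<sigma>_def]
  have "(((H oo Z) - H) oo \<tau>) oo \<sigma> = (H oo Z) - H"
    using fps_compose_assoc[OF inv(1) \<tau>(1), of "(H oo Z) - H"] \<tau>(1) lin(2)
    by (simp add: \<sigma>_def fps_inv_right)
  then have "(H oo Z) - H = \<sigma> ^ (p + q + 1) * (R oo \<sigma>)"
    unfolding R using inv(1) by (simp only: fps_compose_mult_distrib[OF inv(1)] fps_compose_power[OF inv(1), symmetric]) simp
  moreover have "\<sigma> = fps_X * fps_shift 1 \<sigma>" using inv(1) by (intro fps_ext) auto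
  ultimately have "(H oo Z) - H = fps_X ^ (p + q + 1) * (fps_shift 1 \<sigma> ^ (p + q + 1) * (R oo \<sigma>))"
    by (metis power_mult_distrib mult.assoc)
  then have "((H oo Z) - H) $ i = 0" using i(1) by (simp only: fps_X_power_mult_nth) simp
  then have "\<zeta> ^ i * H $ i = H $ i" by (simp add: Z_def fps_compose_linear)
  then show ?thesis using i(2) by simp
qed

end

text \<open>
  A root of \<open>1 + X + \<dots> + X\<^bsup>l-1\<^esup>\<close>; it differs from \<open>1\<close> because \<open>l \<noteq> 0\<close> in characteristic zero.
\<close>

lemma exists_nontrivial_root_of_unity:
  assumes l: "prime l"
  shows "\<exists>\<zeta> :: 'k::{alg_closed_field, field_char_0}. \<zeta> ^ l = 1 \<and> (\<forall>i. \<not> l dvd i \<longrightarrow> \<zeta> ^ i \<noteq> 1)"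
proof -
  have l1: "l > 1" using l by (rule prime_gt_1_nat)
  obtain \<zeta> :: 'k where "(\<Sum>k\<le>l - 1. 1 * \<zeta> ^ k) = 0"
    using alg_closed[of "l - 1" "\<lambda>_. 1 :: 'k"] l1 by auto
  then have \<zeta>: "(\<Sum>k<l. \<zeta> ^ k) = 0" using l1 by (simp add: lessThan_Suc_atMost[symmetric])
  have pow: "\<zeta> ^ l = 1"
    using power_diff_1_eq[of \<zeta> l] by (simp add: \<zeta>)
  have "\<zeta> \<noteq> 1" using \<zeta> l1 by auto
  have "\<zeta> ^ i \<noteq> 1" if "\<not> l dvd i" for i
  proof
    assume i: "\<zeta> ^ i = 1"
    have "coprime i l" using prime_imp_coprime[OF l that] by (simp add: coprime_commute)
    moreover have "i \<noteq> 0" using that by (cases i) auto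
    ultimately obtain x y where "i * x = l * y + 1" using bezout_nat[of i l] by auto
    then have "(\<zeta> ^ i) ^ x = (\<zeta> ^ l) ^ y * \<zeta>" by (simp flip: power_mult)
    then show False using i pow \<open>\<zeta> \<noteq> 1\<close> by simp
  qed
  then show ?thesis using pow by blast
qed

lemma in_ramified_support:
  assumes m: "0 < m" "0 < m'" and u: "in_ramified m m' u" and j: "u $$ j \<noteq> 0"
  shows "int (m div gcd m m') dvd j"
proof -
  obtain h where h: "fls_compose_power u m' = fls_compose_power h m" using u by (auto simp: in_ramified_def)
  have "fls_compose_power u m' $$ (int m' * j) \<noteq> 0" using m j by (simp add: fls_nth_compose_power)
  then have dvd: "int m dvd int m' * j" unfolding h using m by (auto simp: fls_nth_compose_power split: if_splits)
  define d where "d = gcd m m'"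
  have d: "d > 0" using m by (simp add: d_def)
  have "m = d * (m div d)" "m' = d * (m' div d)" by (simp_all add: d_def)
  then have "int d * int (m div d) dvd int d * (int (m' div d) * j)"
    using dvd by (metis mult.assoc of_nat_mult)
  then have "int (m div d) dvd int (m' div d) * j" using d by simp
  moreover have "coprime (int (m div d)) (int (m' div d))"
    using m unfolding d_def by (simp add: div_gcd_coprime)
  ultimately show ?thesis by (simp add: d_def coprime_dvd_mult_right_iff)
qed

lemma in_ramified_divisor:
  fixes u :: "'k::zero fls"
  assumes l: "l > 0" "l dvd q" "q > 0" and u: "\<And>j. u $$ j \<noteq> 0 \<Longrightarrow> int l dvd j"
  shows "in_ramified q (q div l) u"
proof -
  define h where "h = Abs_fls (\<lambda>n. u $$ (int l * n))"
  define N where "N = - \<bar>fls_subdegree u\<bar>"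
  have h: "h $$ n = u $$ (int l * n)" for n
  proof -
    have "u $$ (int l * n) = 0" if "n < N" for n
    proof -
      have "n < 0" using that by (simp add: N_def)
      then have "int l * n \<le> n" using l(1) mult_right_mono_neg[of 1 "int l" n] by simp
      then show ?thesis using that by (intro fls_eq0_below_subdegree) (simp add: N_def)
    qed
    then show ?thesis unfolding h_def by (intro nth_Abs_fls_lower_bound[of N]) simp
  qed
  obtain k where k: "q = l * k" using l(2) by (rule dvdE)
  then have k0: "k > 0" using l(3) by simp
  have "fls_compose_power u k $$ n = fls_compose_power h q $$ n" for n
  proof (cases "int k dvd n")
    case True
    then obtain m where n: "n = int k * m" by (rule dvdE)
    show ?thesis
    proof (cases "int l dvd m")
      case True
      then obtain m' where "m = int l * m'" by (rule dvdE)
      then have "n = int q * m'" by (simp add: n k)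
      then have "fls_compose_power h q $$ n = u $$ m"
        using \<open>m = _\<close> l(3) by (simp add: fls_nth_compose_power h)
      then show ?thesis using n k0 by (simp add: fls_nth_compose_power)
    next
      case False
      then have "u $$ m = 0" using u by blast
      moreover have "\<not> int q dvd n" using False k0 by (simp add: n k)
      ultimately show ?thesis using n k0 l(3) by (simp add: fls_nth_compose_power)
    qed
  next
    case False
    then have "\<not> int q dvd n" by (auto simp: k dest: dvd_mult_right)
    then show ?thesis using False k0 l(3) by (simp add: fls_nth_compose_power)
  qed
  then have "fls_compose_power u k = fls_compose_power h q" by (intro fls_eqI)
  moreover have "q div l = k" using l(1) k by simp
  ultimately show ?thesis unfolding in_ramified_def by blast
qed

context mellin_system
begin

text \<open>
  The classes in \<open>S\<^sub>q\<close> do not see relative orders above \<open>q\<close>, so \<open>g\<close> may be cut off after order \<open>p + q\<close>.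
\<close>

lemma truncation_in_S_class:
  "fps_to_fls (fps_cutoff (p + q + 1) (fps_X ^ p * K0)) \<in> S_class q g"
proof -
  define G where "G = fps_X ^ p * K0"
  define r where "r = - (fps_shift (p + q + 1) G * inverse K0)"
  have "fps_cutoff N G = G - fps_X ^ N * fps_shift N G" for N
    by (rule fps_ext) (auto simp: fps_X_power_mult_nth)
  then have "fps_cutoff (p + q + 1) G = G - fps_X ^ (p + q + 1) * fps_shift (p + q + 1) G" .
  also have "\<dots> = G * (1 + fps_X ^ (q + 1) * r)"
  proof -
    have "K0 * inverse K0 = 1" using K0 a by (simp add: inverse_mult_eq_1')
    then have "G * (fps_X ^ (q + 1) * r) = - (fps_X ^ (p + q + 1) * fps_shift (p + q + 1) G)"
      unfolding r_def by (subst (1) G_def) (simp add: power_add mult_ac)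
    then show ?thesis by (simp add: distrib_left)
  qed
  finally have "fps_to_fls (fps_cutoff (p + q + 1) G) =
      fps_to_fls G * (1 + fls_X ^ (q + 1) * fps_to_fls r)"
    by (simp only: fls_times_fps_to_fls fps_to_fls_plus fps_one_to_fls fps_to_fls_power fps_X_to_fls)
  also have "fps_to_fls G = galois 1 g"
    by (rule fls_eqI) (simp add: galois_nth g G_def fls_times_fps_to_fls fps_to_fls_power)
  finally have "fps_to_fls (fps_cutoff (p + q + 1) G) =
      galois 1 g * (1 + fls_const (of_int 0 / of_nat q) * fls_X ^ q + fls_X ^ (q + 1) * fps_to_fls r)" by simp
  then show ?thesis unfolding S_class_def G_def
    by (intro CollectI exI[of _ 1] exI[of _ 0] exI[of _ r]) simp
qed

end

text \<open>
  If \<open>f\<close> is equivalent to a series in \<open>z\<^bsup>1/m\<^esup>\<close> with \<open>m < p\<close>, then for some prime \<open>l\<close> dividing \<open>p\<close> the exponents of \<open>f\<close>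
  up to \<open>0\<close> are multiples of \<open>l\<close>.  So is the leading one, \<open>-q\<close>, and \<open>f\<close> is invariant under \<open>s \<mapsto> \<zeta> s\<close> for a
  primitive \<open>l\<close>-th root of unity \<open>\<zeta>\<close>, modulo \<open>s \<Bbbk>[[s]]\<close>.  Hence \<open>g\<close>, up to order \<open>p + q\<close>, is a series in \<open>\<theta>\<^bsup>l/q\<^esup>\<close>,
  against the minimality of \<open>q\<close>.
\<close>

lemma (in mellin_system) solution_in_R_circ:
  assumes roots: "\<And>l. prime l \<Longrightarrow> \<exists>\<zeta> :: 'k. \<zeta> ^ l = 1 \<and> (\<forall>i. \<not> l dvd i \<longrightarrow> \<zeta> ^ i \<noteq> 1)"
    and f: "solves_system p q a g f" and S: "S_class q g \<in> S_circ q"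
  shows "R_class p f \<in> R_circ p"
proof -
  have False if m: "0 < m" "m < p" and f': "f' \<in> R_class p f" "in_ramified p m f'" for m f'
  proof -
    have "p div gcd p m \<noteq> 1"
    proof
      assume "p div gcd p m = 1"
      then have "gcd p m = p" by (metis gcd_dvd1 dvd_div_mult_self mult_1)
      then have "p dvd m" by (metis gcd_dvd2)
      then show False using m by (auto dest: dvd_imp_le)
    qed
    then obtain l where l: "prime l" "l dvd p div gcd p m" using prime_factor_nat by blast
    have l_supp: "int l dvd j" if "f' $$ j \<noteq> 0" for j
      using in_ramified_support[OF p m(1) f'(2) that] l(2) by (meson dvd_trans of_nat_dvd_iff)
    obtain \<eta> n r where \<eta>: "\<eta> ^ p = 1"
      and f'_eq: "f' = galois \<eta> f + fls_const (of_int n / of_nat p) + fls_X * fps_to_fls r"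
      using f'(1) unfolding R_class_def by blast
    have \<eta>0: "\<eta> \<noteq> 0" using \<eta> p by (auto simp: power_0_left)
    have supp: "f $$ j = 0" if "j \<le> 0" "\<not> int l dvd j" for j
    proof -
      have "j \<noteq> 0" using that by auto
      have "f' $$ j = 0" using l_supp that by blast
      then show ?thesis using that \<open>j \<noteq> 0\<close> \<eta>0 by (simp add: f'_eq galois_nth fls_X_times_conv_shift)
    qed
    obtain \<tau> where \<tau>: "\<tau> $ 0 = 0" "H oo \<tau> = fps_X ^ p" and f_eq: "f = - inverse (fps_to_fls \<tau> ^ q)"
      using f unfolding solves_system_iff by blast
    note lin = solution_linear[OF \<tau>]
    have "f = - (fps_to_fls \<tau> powi (- int q))" by (simp add: f_eq power_int_minus)
    then have "f $$ (- int q) \<noteq> 0" using ord_ge_linear_fps_powi(2)[OF \<tau>(1) lin(2), of "- int q"] lin(2) by simp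
    then have lq: "l dvd q" using supp[of "- int q"] by auto
    have lp: "l dvd p" using l(2) by (metis dvd_trans dvd_div_mult_self dvd_triv_left gcd_dvd1)
    obtain \<zeta> :: 'k where \<zeta>: "\<zeta> ^ l = 1" "\<And>i. \<not> l dvd i \<Longrightarrow> \<zeta> ^ i \<noteq> 1"
      using roots[OF l(1)] by blast
    have \<zeta>_dvd: "\<zeta> ^ i = 1" if "l dvd i" for i using that \<zeta>(1) by (auto simp: power_mult elim!: dvdE)
    have \<zeta>0: "\<zeta> \<noteq> 0" using \<zeta>_dvd[OF lp] p by (auto simp: power_0_left)
    have "ord_ge 1 (f - galois \<zeta> f)"
      unfolding ord_ge_def
    proof (intro allI impI)
      fix j :: int assume j: "j < 1"
      show "(f - galois \<zeta> f) $$ j = 0"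
      proof (cases "int l dvd j")
        case True
        then obtain k where "j = int l * k" by (rule dvdE)
        then have "\<zeta> powi j = 1" using \<zeta>(1) by (simp add: power_int_mult)
        then show ?thesis using \<zeta>0 by (simp add: galois_nth)
      qed (use j supp \<zeta>0 in \<open>simp add: galois_nth\<close>)
    qed
    note H0 = ramification_of_solution[OF f \<zeta>_dvd[OF lp] \<zeta>_dvd[OF lq] this]
    define g' where "g' = fps_cutoff (p + q + 1) (fps_X ^ p * K0)"
    have g'_supp: "l dvd i" if "g' $ i \<noteq> 0" for i
    proof (rule ccontr)
      assume i: "\<not> l dvd i"
      have "i \<le> p + q" using that by (auto simp: g'_def split: if_splits)
      then have "H $ i = 0" using H0 \<zeta>(2)[OF i] by blast
      moreover have "i \<noteq> p + q" using i lp lq by auto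
      have "H = fps_X ^ p * K0 + fps_const (a * (of_nat (p + q) / of_nat (2 * q))) * fps_X ^ (p + q)"
        by (simp add: H_def K_def algebra_simps power_add)
      then have "H $ i = (fps_X ^ p * K0) $ i"
        using \<open>i \<noteq> p + q\<close> by (simp only: fps_add_nth fps_mult_left_const_nth fps_X_power_nth) simp
      ultimately show False using that \<open>i \<le> p + q\<close> by (simp add: g'_def)
    qed
    have "in_ramified q (q div l) (fps_to_fls g')"
    proof (rule in_ramified_divisor[OF _ lq q])
      show "l > 0" using l(1) by (rule prime_gt_0_nat)
      show "int l dvd j" if "fps_to_fls g' $$ j \<noteq> 0" for j
        using that g'_supp[of "nat j"] by (cases "j < 0") (auto simp flip: int_dvd_int_iff)
    qed
    moreover have "0 < q div l" "q div l < q"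
      using lq q prime_gt_1_nat[OF l(1)] by (auto simp: div_greater_zero_iff intro: dvd_imp_le)
    ultimately show False
      using S truncation_in_S_class unfolding S_circ_def g'_def by blast
  qed
  then show ?thesis unfolding R_circ_def R_set_def by blast
qed

theorem theorem10p5:
  fixes p q :: nat and a :: "'k::{alg_closed_field, field_char_0}" and g :: "'k fls"
  assumes "p > 0" and "q > 0"
    and "S_class q g \<in> S_circ q"
    and "a \<noteq> 0"
    and "\<exists>r. g = fls_const a * fls_X ^ p + fls_X ^ (p + 1) * fps_to_fls r"
  shows "(\<exists>f. solves_system p q a g f) \<and>
         (\<forall>f f'. solves_system p q a g f \<longrightarrow> solves_system p q a g f' \<longrightarrow> R_class p f = R_class p f') \<and>
         (\<forall>f. solves_system p q a g f \<longrightarrow>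
            R_class p f \<in> R_circ p \<and> connection_iso (inverse_mellin (D_obj q g)) (E_obj p f))"
proof -
  obtain r where r: "g = fls_const a * fls_X ^ p + fls_X ^ (p + 1) * fps_to_fls r" using assms(5) by blast
  define K0 where "K0 = fps_const a + fps_X * r"
  have "g = fls_X ^ p * fps_to_fls K0"
    by (simp add: r K0_def fls_times_fps_to_fls algebra_simps)
  then interpret mellin_system p q a g K0
    using assms(1,2,4) by unfold_locales (simp_all add: K0_def)
  obtain b where "b ^ p = a" using nth_root_exists[OF \<open>p > 0\<close>, of a] by blast
  then show ?thesis
    using solution_exists solution_unique solution_connection_iso
      solution_in_R_circ[OF exists_nontrivial_root_of_unity _ assms(3)] by blast
qed

end
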